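(* Let $0<p,q<\infty$ and $0<\sigma_i\le q$, $-1<\alpha_i<\infty$ for $i=1,\ldots,m$. Let $\mu$ be a positive Borel measure on $\mathbb H$. Then the following two conditions are equivalent. (1) There is a constant $C>0$ such that for any $m$-tuple $(f_1,\ldots,f_m)$ of harmonic functions on $\mathbb H$, $$\|(f_1,\ldots,f_m)\|_{A(p,q,m,d\mu)}^q\le C\prod_{i=1}^m\int_{\mathbb H}\left(\int_{Q_w}|f_i(z)|^{\sigma_i}t^{\alpha_i}\,dz\right)^{q/\sigma_i}dw.$$ (2) There is a constant $C>0$ such that $$\mu(\Delta_k)\le C\,\eta_k^{m(n+1)\frac pq+\sum_{i=1}^m\frac{p(n+1+\alpha_i)}{\sigma_i}},\qquad k\ge1.$$
   Context: $\mathbb H=\{(x,t):x\in\mathbb R^n,\ t>0\}\subset\mathbb R^{n+1}$; points are written $z=(x,t)$ or $w=(y,s)$, and $dz=dx\,dt$, $dw=dy\,ds$ denote Lebesgue measure. $A\asymp B$ means $cA\le B\le CA$ for some constants $c,C>0$. For $w=(y,s)\in\mathbb H$, $Q_w$ is the cube with sides parallel to the coordinate axes, centered at $w$, with side length $s$. $\{\Delta_k\}_{k\ge1}$ is a fixed Whitney decomposition of $\mathbb H$: closed cubes in $\mathbb H$ with sides parallel to the coordinate axes, with pairwise disjoint interiors, $\bigcup_k\Delta_k=\mathbb H$, and $\operatorname{diam}\Delta_k\asymp\operatorname{dist}(\Delta_k,\partial\mathbb H)$ uniformly in $k$. $\zeta_k=(\xi_k,\eta_k)$ is the center of $\Delta_k$.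 $\Delta_k^\ast$ is the cube with the same center as $\Delta_k$ enlarged $5/4$ times; these satisfy $\Delta_k^\ast\subset\mathbb H$, $\sum_k\chi_{\Delta_k^\ast}\le C_n$, and $t\asymp\eta_k$ for $(x,t)\in\Delta_k^\ast$, uniformly in $k$. For $0<p,q<\infty$, a positive Borel measure $\mu$ on $\mathbb H$ and harmonic functions $f_1,\ldots,f_m$ on $\mathbb H$, $$\|(f_1,\ldots,f_m)\|_{A(p,q,m,d\mu)}^q=\sum_{k=1}^\infty\left(\int_{\Delta_k}\prod_{i=1}^m|f_i(z)|^p\,d\mu(z)\right)^{q/p}.$$ *)

theory Defs
  imports "HOL-Analysis.Analysis"
begin

definition half_space :: "((real ^ 'n) \<times> real) set" where
  "half_space = {z. 0 < snd z}"

text \<open>The cube with centre \<open>c\<close>, side length \<open>l\<close> and sides parallel to the axes;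
  \<open>One\<close> is the sum of the standard basis vectors.\<close>

definition axis_cube :: "'a::euclidean_space \<Rightarrow> real \<Rightarrow> 'a set" where
  "axis_cube c l = cbox (c - (l / 2) *\<^sub>R One) (c + (l / 2) *\<^sub>R One)"

definition Q_cube :: "(real ^ 'n) \<times> real \<Rightarrow> ((real ^ 'n) \<times> real) set" where
  "Q_cube w = axis_cube w (snd w)"

text \<open>\<open>\<Delta> k\<close> is the \<open>k\<close>-th cube and \<open>\<zeta> k\<close> its centre. The sequence is indexed from \<open>0\<close>,
  and the constants \<open>a\<close>, \<open>b\<close> of comparability are not prescribed.\<close>

definition whitney_decomposition ::
  "(nat \<Rightarrow> ((real ^ 'n) \<times> real) set) \<Rightarrow> (nat \<Rightarrow> (real ^ 'n) \<times> real) \<Rightarrow> bool" where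
  "whitney_decomposition \<Delta> \<zeta> \<longleftrightarrow>
     (\<forall>k. \<exists>l>0. \<Delta> k = axis_cube (\<zeta> k) l) \<and>
     (\<forall>j k. j \<noteq> k \<longrightarrow> interior (\<Delta> j) \<inter> interior (\<Delta> k) = {}) \<and>
     (\<Union>k. \<Delta> k) = half_space \<and>
     (\<exists>a>0. \<exists>b>0. \<forall>k.
        a * setdist (\<Delta> k) (frontier half_space) \<le> diameter (\<Delta> k) \<and>
        diameter (\<Delta> k) \<le> b * setdist (\<Delta> k) (frontier half_space))"

definition partial :: "'a::euclidean_space \<Rightarrow> ('a \<Rightarrow> real) \<Rightarrow> 'a \<Rightarrow> real" where
  "partial b f z = deriv (\<lambda>h. f (z + h *\<^sub>R b)) 0"

definition has_partial :: "'a::euclidean_space \<Rightarrow> ('a \<Rightarrow> real) \<Rightarrow> 'a \<Rightarrow> bool" where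
  "has_partial b f z \<longleftrightarrow> (\<lambda>h. f (z + h *\<^sub>R b)) field_differentiable (at 0)"

text \<open>The following three notions are meant for open sets \<open>S\<close>.\<close>

definition C1_on :: "'a::euclidean_space set \<Rightarrow> ('a \<Rightarrow> real) \<Rightarrow> bool" where
  "C1_on S f \<longleftrightarrow> continuous_on S f \<and>
     (\<forall>b\<in>Basis. (\<forall>z\<in>S. has_partial b f z) \<and> continuous_on S (partial b f))"

definition C2_on :: "'a::euclidean_space set \<Rightarrow> ('a \<Rightarrow> real) \<Rightarrow> bool" where
  "C2_on S f \<longleftrightarrow> C1_on S f \<and> (\<forall>b\<in>Basis. C1_on S (partial b f))"

definition laplacian :: "('a::euclidean_space \<Rightarrow> real) \<Rightarrow> 'a \<Rightarrow> real" where
  "laplacian f z = (\<Sum>b\<in>Basis. partial b (partial b f) z)"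

definition harmonic_on :: "'a::euclidean_space set \<Rightarrow> ('a \<Rightarrow> real) \<Rightarrow> bool" where
  "harmonic_on S f \<longleftrightarrow> C2_on S f \<and> (\<forall>z\<in>S. laplacian f z = 0)"

text \<open>Real powers of extended nonnegative reals, only meant for positive exponents.\<close>

definition ennreal_powr :: "ennreal \<Rightarrow> real \<Rightarrow> ennreal" where
  "ennreal_powr x r = (if x = top then top else ennreal (enn2real x powr r))"

text \<open>The \<open>q\<close>-th power of the quasinorm of the tuple \<open>(f 1, \<dots>, f m)\<close> in \<open>A(p, q, m, d\<mu>)\<close>.\<close>

definition A_norm_powr ::
  "(nat \<Rightarrow> ((real ^ 'n) \<times> real) set) \<Rightarrow> real \<Rightarrow> real \<Rightarrow> nat \<Rightarrow> ((real ^ 'n) \<times> real) measure \<Rightarrow>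
   (nat \<Rightarrow> (real ^ 'n) \<times> real \<Rightarrow> real) \<Rightarrow> ennreal" where
  "A_norm_powr \<Delta> p q m \<mu> f =
     (\<Sum>k. ennreal_powr (\<integral>\<^sup>+z\<in>\<Delta> k. ennreal (\<Prod>i=1..m. \<bar>f i z\<bar> powr p) \<partial>\<mu>) (q / p))"

end

theory Submission
  imports Defs
begin

text \<open>
  From (2) to (1): a harmonic function satisfies
  \<open>\<bar>f z\<bar> powr \<sigma> \<le> C * r powr - d * (\<integral>x\<in>cball z r. \<bar>f x\<bar> powr \<sigma>)\<close> for every \<open>\<sigma> > 0\<close>. Hence the maximum of
  \<open>\<bar>f\<bar> powr q\<close> over a Whitney cube, times the appropriate power of the height of the cube, is bounded
  by the integral of the inner \<open>Q_cube\<close> integrals over a piece of that cube, and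
  \<open>\<Sum>k. \<Prod>i. a i k \<le> \<Prod>i. \<Sum>k. a i k\<close> for nonnegative terms.

  From (1) to (2): test with \<open>m\<close> copies of one harmonic function of arbitrarily fast decay
  \<open>norm (z - a) powr - N\<close>, the Kelvin transform of a homogeneous harmonic polynomial, with pole \<open>a\<close>
  below the boundary at a distance comparable to the height of the cube.

  The mean value property is obtained with the weight \<open>max 0 (1 - y \<bullet> y)\<close> in place of the
  surface measure: the weighted average of \<open>f (z + r *\<^sub>R y)\<close> over \<open>y\<close> has zero derivative in \<open>r\<close>, since the
  integral of a directional derivative of a compactly supported function vanishes by translation
  invariance of the Lebesgue measure.
\<close>

section \<open>Functions with continuous partial derivatives\<close>

text \<open>The exponent in (2) is a matter of scaling. Let d = n + 1. On a cube of height \<eta>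
  the inner integral has size \<eta>^(d + \<alpha>) |f|^\<sigma>, and letting w run over the cube
  contributes another \<eta>^d. So the i-th factor carries the power d + (d + \<alpha>_i) q /
  \<sigma>_i of the height, and the exponent in (2) is p/q times the sum of these powers. The proof
  uses it in this form.

  The obstacle in deducing (2) is that the outer integrals of the test function must converge for
  all i at once, which asks for fast decay, while a homogeneous harmonic polynomial of positive
  degree changes sign. Homogeneity helps: positivity at one point of the sphere persists in a cone,
  and a pole deep enough below the boundary sees the whole cube inside this cone. There the lower
  bound has the same power of the distance as the global upper bound, so the decay rate cancels from
  the final estimate.\<close>

lemma has_partialD:
  assumes "has_partial b f (z + s *\<^sub>R b)"
  shows "((\<lambda>h. f (z + h *\<^sub>R b)) has_real_derivative partial b f (z + s *\<^sub>R b)) (at s)"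
proof -
  have "((\<lambda>h. f (z + s *\<^sub>R b + h *\<^sub>R b)) has_real_derivative partial b f (z + s *\<^sub>R b)) (at 0)"
    using assms unfolding has_partial_def partial_def
    by (simp add: DERIV_deriv_iff_field_differentiable)
  then show ?thesis
    using DERIV_shift[of "\<lambda>h. f (z + h *\<^sub>R b)" "partial b f (z + s *\<^sub>R b)" 0 s]
    by (simp add: algebra_simps)
qed

text \<open>\<open>C1_on\<close> speaks only of one-variable derivatives along the axes, but the
  mean value property differentiates \<open>f\<close> along rays in every direction. Moving from
  \<open>x\<close> to \<open>y\<close> one coordinate at a time, each move costs an error of at most
  \<open>e' * norm u\<close>, because the partial derivatives are nearly constant near
  \<open>x\<close>.\<close>

lemma C1_on_has_derivative:
  fixes f :: "'a::euclidean_space \<Rightarrow> real"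
  assumes "open S" "C1_on S f" "x \<in> S"
  shows "(f has_derivative (\<lambda>h. \<Sum>b\<in>Basis. (h \<bullet> b) * partial b f x)) (at x)"
  unfolding has_derivative_at_alt
proof (intro conjI allI impI)
  show "bounded_linear (\<lambda>h. \<Sum>b\<in>Basis. (h \<bullet> b) * partial b f x)"
    by (intro bounded_linear_sum bounded_linear_mult_left[THEN bounded_linear_compose]
        bounded_linear_inner_left)
next
  fix e :: real assume "0 < e"
  define e' where "e' = e / DIM('a)"
  have e': "0 < e'" "e' * DIM('a) = e" using \<open>0 < e\<close> by (auto simp: e'_def)
  have "\<forall>\<^sub>F y in nhds x. \<forall>b\<in>Basis. y \<in> S \<and> \<bar>partial b f y - partial b f x\<bar> < e'"
  proof (intro eventually_ball_finite finite_Basis ballI)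
    fix b :: 'a assume "b \<in> Basis"
    then have "continuous_on S (partial b f)" using assms(2) by (auto simp: C1_on_def)
    then have "isCont (partial b f) x"
      using assms continuous_on_eq_continuous_at by blast
    then have "(partial b f \<longlongrightarrow> partial b f x) (nhds x)"
      by (simp add: isCont_def tendsto_at_iff_tendsto_nhds)
    from tendstoD[OF this e'(1)] eventually_nhds_in_open[OF assms(1,3)]
    show "\<forall>\<^sub>F y in nhds x. y \<in> S \<and> \<bar>partial b f y - partial b f x\<bar> < e'"
      by eventually_elim (simp add: dist_real_def)
  qed
  then obtain d where d: "0 < d"
    "\<And>y b. dist y x < d \<Longrightarrow> b \<in> Basis \<Longrightarrow> y \<in> S \<and> \<bar>partial b f y - partial b f x\<bar> < e'"
    unfolding eventually_nhds_metric by blast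
  show "\<exists>d>0. \<forall>y. norm (y - x) < d \<longrightarrow>
      norm (f y - f x - (\<Sum>b\<in>Basis. ((y - x) \<bullet> b) * partial b f x)) \<le> e * norm (y - x)"
  proof (intro exI[of _ d] conjI d(1) allI impI)
    fix y assume y: "norm (y - x) < d"
    define u where "u = y - x"
    \<comment> \<open>\<open>P B\<close> is the part of the displacement \<open>u\<close> made so
      far, when the coordinates in \<open>B\<close> have been adjusted; the induction adds one
      coordinate per step.\<close>
    define P where "P B = (\<Sum>b\<in>B. (u \<bullet> b) *\<^sub>R b)" for B
    have "\<bar>f (x + P B) - f x - (\<Sum>b\<in>B. (u \<bullet> b) * partial b f x)\<bar> \<le> card B * (e' * norm u)"
      if "finite B" "B \<subseteq> Basis" for B
      using that
    proof (induction B rule: finite_induct)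
      case (insert b B)
      then have b: "b \<in> Basis" and B: "B \<subseteq> Basis" by auto
      define p where "p = x + P B"
      \<comment> \<open>No coordinate of the intermediate displacement exceeds that of
        \<open>u\<close> in absolute value, so the broken path stays in the ball on which the
        partial derivatives are controlled.\<close>
      have near: "dist (p + h *\<^sub>R b) x < d" if "\<bar>h\<bar> \<le> \<bar>u \<bullet> b\<bar>" for h :: real
      proof -
        have "norm (P B + h *\<^sub>R b) \<le> norm u"
        proof (rule norm_le_componentwise)
          fix i :: 'a assume i: "i \<in> Basis"
          have "P B \<bullet> i = (\<Sum>c\<in>B. if c = i then u \<bullet> c else 0)"
            unfolding P_def inner_sum_left
            by (rule sum.cong) (use B i in \<open>auto simp: inner_Basis\<close>)
          then have "P B \<bullet> i = (if i \<in> B then u \<bullet> i else 0)"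
            using insert.hyps(1) by (simp add: sum.delta)
          then show "\<bar>(P B + h *\<^sub>R b) \<bullet> i\<bar> \<le> \<bar>u \<bullet> i\<bar>"
            using that insert.hyps(2) b i by (auto simp: inner_add_left inner_Basis)
        qed
        then show ?thesis using y by (simp add: p_def dist_norm u_def algebra_simps)
      qed
      have "norm ((f (p + (u \<bullet> b) *\<^sub>R b) - (u \<bullet> b) * partial b f x) - (f (p + 0 *\<^sub>R b) - 0 * partial b f x))
          \<le> e' * norm (u \<bullet> b - 0)"
      proof (rule field_differentiable_bound[where S = "cball 0 \<bar>u \<bullet> b\<bar>"])
        fix h :: real assume "h \<in> cball 0 \<bar>u \<bullet> b\<bar>"
        then have "\<bar>h\<bar> \<le> \<bar>u \<bullet> b\<bar>" by simp
        note dh = d(2)[OF near[OF this] b]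
        then have "has_partial b f (p + h *\<^sub>R b)" using assms(2) b by (auto simp: C1_on_def)
        from has_partialD[OF this]
        have "((\<lambda>h. f (p + h *\<^sub>R b) - h * partial b f x) has_real_derivative
            partial b f (p + h *\<^sub>R b) - 1 * partial b f x) (at h)"
          by (intro DERIV_diff DERIV_cmult_right DERIV_ident)
        then show "((\<lambda>h. f (p + h *\<^sub>R b) - h * partial b f x) has_real_derivative
            partial b f (p + h *\<^sub>R b) - partial b f x) (at h within cball 0 \<bar>u \<bullet> b\<bar>)"
          using has_field_derivative_at_within by fastforce
        show "norm (partial b f (p + h *\<^sub>R b) - partial b f x) \<le> e'" using dh by simp
      qed auto
      also have "\<dots> \<le> e' * norm u"
        using e' b Basis_le_norm by (auto intro!: mult_left_mono)
      finally have 1: "\<bar>f (p + (u \<bullet> b) *\<^sub>R b) - f p - (u \<bullet> b) * partial b f x\<bar> \<le> e' * norm u"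
        by (simp add: algebra_simps)
      have 2: "\<bar>f p - f x - (\<Sum>b\<in>B. (u \<bullet> b) * partial b f x)\<bar> \<le> card B * (e' * norm u)"
        using insert.IH B by (simp add: p_def)
      have "x + P (insert b B) = p + (u \<bullet> b) *\<^sub>R b"
        using insert.hyps by (simp add: P_def p_def)
      then show ?case using 1 2 insert.hyps by (simp add: algebra_simps)
    qed (simp add: P_def)
    from this[OF finite_Basis order_refl]
    have "\<bar>f (x + u) - f x - (\<Sum>b\<in>Basis. (u \<bullet> b) * partial b f x)\<bar> \<le> DIM('a) * (e' * norm u)"
      by (simp add: P_def euclidean_representation)
    then show "norm (f y - f x - (\<Sum>b\<in>Basis. ((y - x) \<bullet> b) * partial b f x)) \<le> e * norm (y - x)"
      using e'(2) by (simp add: u_def mult.assoc[symmetric] mult.commute)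
  qed
qed

section \<open>Cut-off functions and integrals of directional derivatives\<close>

text \<open>Outside its open set nothing is known about a harmonic function or its partial
  derivatives, so \<open>u\<close> is controlled only on \<open>T\<close>. The factor \<phi> hides
  the rest: \<open>A \<inter> T\<close> and \<open>A - K\<close> are relatively open and cover
  \<open>A\<close>, and the product is continuous on the first and 0 on the second.\<close>

lemma continuous_on_mult_extend_zero:
  fixes u \<phi> :: "'a::t2_space \<Rightarrow> real"
  assumes "open T" "continuous_on (A \<inter> T) u" "continuous_on A \<phi>" "closed K"
    and "A \<inter> K \<subseteq> T" "\<And>x. x \<in> A \<Longrightarrow> x \<notin> K \<Longrightarrow> \<phi> x = 0"
  shows "continuous_on A (\<lambda>x. \<phi> x * u x)"
  unfolding continuous_on_eq_continuous_within[of A "\<lambda>x. \<phi> x * u x"]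
proof
  have 1: "continuous_on (A \<inter> T) (\<lambda>x. \<phi> x * u x)"
    using assms(2,3) by (auto intro!: continuous_intros intro: continuous_on_subset)
  have 2: "continuous_on (A - K) (\<lambda>x. \<phi> x * u x)"
    using assms(6) by (auto intro: continuous_on_eq[OF continuous_on_const[of _ 0]])
  fix x assume x: "x \<in> A"
  show "continuous (at x within A) (\<lambda>x. \<phi> x * u x)"
  proof (cases "x \<in> T")
    case True
    then have "at x within A = at x within (A \<inter> T)"
      using assms(1) by (intro at_within_nhd[of _ T]) auto
    then show ?thesis using 1 x True by (simp add: continuous_on_eq_continuous_within)
  next
    case False
    then have "x \<notin> K" using assms(5) x by auto
    then have "at x within A = at x within (A - K)"
      using assms(4) by (intro at_within_nhd[of _ "- K"]) auto
    then show ?thesis using 2 x \<open>x \<notin> K\<close> by (simp add: continuous_on_eq_continuous_within)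
  qed
qed

lemma integrable_lborel_continuous_support:
  fixes g :: "'a::euclidean_space \<Rightarrow> real"
  assumes "continuous_on UNIV g" "\<And>y. y \<notin> cball 0 R \<Longrightarrow> g y = 0"
  shows "integrable lborel g"
proof -
  have "integrable lborel (\<lambda>y. indicator (cball 0 R) y *\<^sub>R g y)"
    using assms(1) by (intro borel_integrable_compact) (auto intro: continuous_on_subset)
  moreover have "(\<lambda>y. indicator (cball 0 R) y *\<^sub>R g y) = g"
    using assms(2) by (auto simp: indicator_def fun_eq_iff)
  ultimately show ?thesis by simp
qed

text \<open>Dominated convergence passes from difference quotients, which integrate to 0, to the
  derivative. The bound on the quotients comes from the mean value inequality, as the continuous
  \<open>g'\<close> is bounded on compact balls.\<close>

lemma integral_directional_derivative_eq_0:
  fixes g g' :: "'a::euclidean_space \<Rightarrow> real"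
  assumes der: "\<And>y. ((\<lambda>s. g (y + s *\<^sub>R b)) has_real_derivative g' y) (at 0)"
    and "continuous_on UNIV g" and "continuous_on UNIV g'"
    and zero: "\<And>y. y \<notin> cball 0 R \<Longrightarrow> g y = 0"
  shows "integral\<^sup>L lborel g' = 0"
proof -
  have meas[measurable]: "g \<in> borel_measurable borel" "g' \<in> borel_measurable borel"
    using assms by (auto intro: borel_measurable_continuous_onI)
  have der': "((\<lambda>s. g (y + s *\<^sub>R b)) has_real_derivative g' (y + s *\<^sub>R b)) (at s)" for y s
    using der[of "y + s *\<^sub>R b"] DERIV_shift[of "\<lambda>h. g (y + h *\<^sub>R b)" "g' (y + s *\<^sub>R b)" 0 s]
    by (simp add: algebra_simps)
  \<comment> \<open>Since \<open>s n\<close> is at most 1, every quotient vanishes outside the ball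
    of radius \<open>R'\<close>. For \<open>y\<close> in that ball, the segment to
    \<open>y + s n *\<^sub>R b\<close> stays within radius \<open>R' + norm b\<close>, where
    \<open>K\<close> bounds \<open>g'\<close>.\<close>
  define R' where "R' = R + norm b"
  obtain K where K: "0 < K" "\<And>y. y \<in> cball 0 (R' + norm b) \<Longrightarrow> \<bar>g' y\<bar> \<le> K"
  proof -
    have "compact (g' ` cball 0 (R' + norm b))"
      using assms(3) by (intro compact_continuous_image) (auto intro: continuous_on_subset)
    from compact_imp_bounded[OF this, unfolded bounded_pos]
    show thesis using that by auto
  qed
  define s where "s n = 1 / (real n + 1)" for n
  have s: "0 < s n" "s n \<le> 1" for n by (auto simp: s_def)
  have s0: "s \<longlonglongrightarrow> 0" unfolding s_def
    using LIMSEQ_inverse_real_of_nat by (simp add: inverse_eq_divide add.commute)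
  define D where "D n y = (g (y + s n *\<^sub>R b) - g y) / s n" for n y
  have "(\<lambda>n. integral\<^sup>L lborel (D n)) \<longlonglongrightarrow> integral\<^sup>L lborel g'"
  proof (rule integral_dominated_convergence[where w = "\<lambda>y. indicator (cball 0 R') y *\<^sub>R K"])
    show "D n \<in> borel_measurable lborel" for n unfolding D_def by measurable
    show "integrable lborel (\<lambda>y. indicator (cball 0 R' :: 'a set) y *\<^sub>R K)"
      by (intro integrable_real_indicator integrable_scaleR_left)
        (auto simp: emeasure_lborel_cball_finite[unfolded infinity_ennreal_def])
    show "AE x in lborel. (\<lambda>n. D n x) \<longlonglongrightarrow> g' x"
    proof (rule AE_I2)
      fix y
      have "((\<lambda>h. (g (y + h *\<^sub>R b) - g y) / h) \<longlongrightarrow> g' y) (at 0)"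
        using der[of y] by (simp add: DERIV_def)
      moreover have "filterlim s (at 0) sequentially"
        using s0 s(1) by (auto simp: filterlim_at intro!: always_eventually) (metis less_irrefl)
      ultimately show "(\<lambda>n. D n y) \<longlonglongrightarrow> g' y"
        unfolding D_def by (rule filterlim_compose)
    qed
    show "AE x in lborel. norm (D n x) \<le> indicator (cball 0 R') x *\<^sub>R K" for n
    proof (rule AE_I2)
      fix y
      have sb: "norm (h *\<^sub>R b) \<le> norm b" if "h \<in> {0..1}" for h
        using that by (auto intro: mult_left_le_one_le)
      show "norm (D n y) \<le> indicator (cball 0 R') y *\<^sub>R K"
      proof (cases "y \<in> cball 0 R'")
        case True
        have "norm (g (y + s n *\<^sub>R b) - g (y + 0 *\<^sub>R b)) \<le> K * norm (s n - 0)"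
        proof (rule field_differentiable_bound[where S = "{0..1}"])
          show "((\<lambda>s. g (y + s *\<^sub>R b)) has_real_derivative g' (y + h *\<^sub>R b)) (at h within {0..1})" for h
            using der' has_field_derivative_at_within by blast
          fix h :: real assume "h \<in> {0..1}"
          then show "norm (g' (y + h *\<^sub>R b)) \<le> K"
            using True sb[of h] norm_triangle_ineq[of y "h *\<^sub>R b"] by (auto intro!: K)
        qed (use s in \<open>auto intro: less_imp_le\<close>)
        then show ?thesis using s(1)[of n] True by (simp add: D_def field_simps)
      next
        case False
        then have "g y = 0" by (intro zero) (auto simp: R'_def intro: order.trans)
        moreover have "g (y + s n *\<^sub>R b) = 0"
        proof (rule zero)
          have "norm y \<le> norm (y + s n *\<^sub>R b) + norm b"
            using norm_triangle_ineq4[of "y + s n *\<^sub>R b" "s n *\<^sub>R b"] sb[of "s n"] s[of n] by auto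
          then show "y + s n *\<^sub>R b \<notin> cball 0 R" using False by (auto simp: R'_def)
        qed
        ultimately show ?thesis by (simp add: D_def K less_imp_le)
      qed
    qed
  qed measurable
  moreover have "integral\<^sup>L lborel (D n) = 0" for n
  proof -
    have int: "integrable lborel g"
      using assms(2) zero by (rule integrable_lborel_continuous_support)
    have "integrable (distr lborel borel ((+) (s n *\<^sub>R b))) g"
      using int by (simp add: lborel_distr_plus)
    then have int2: "integrable lborel (\<lambda>y. g (y + s n *\<^sub>R b))"
      by (subst (asm) integrable_distr_eq) (auto simp: add.commute)
    have "integral\<^sup>L lborel g = integral\<^sup>L (distr lborel borel ((+) (s n *\<^sub>R b))) g"
      by (simp add: lborel_distr_plus)
    also have "\<dots> = integral\<^sup>L lborel (\<lambda>y. g (y + s n *\<^sub>R b))"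
      by (subst integral_distr) (auto simp: add.commute)
    finally show ?thesis unfolding D_def using int int2 by simp
  qed
  ultimately show ?thesis using LIMSEQ_unique[OF _ tendsto_const[of 0]] by simp
qed

section \<open>The mean value property\<close>

text \<open>Squaring removes the kink of the positive part at 0. Thus
  \<open>(bump y)\<^sup>2\<close> is differentiable across the unit sphere, where
  \<open>bump\<close> itself is not.\<close>

lemma has_real_derivative_pos_part_square:
  "((\<lambda>u::real. (max 0 u)\<^sup>2) has_real_derivative 2 * max 0 u) (at u)"
proof (cases "u = 0")
  case True
  have "((\<lambda>h::real. (max 0 h)\<^sup>2 / h) \<longlongrightarrow> 0) (at 0)"
  proof (rule tendsto_0_le[where K = 1])
    show "((\<lambda>h::real. h) \<longlongrightarrow> 0) (at 0)" by (rule tendsto_ident_at)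
    show "\<forall>\<^sub>F h::real in at 0. norm ((max 0 h)\<^sup>2 / h) \<le> norm h * 1"
      by (intro always_eventually allI) (auto simp: max_def power2_eq_square)
  qed
  then show ?thesis using True by (simp add: DERIV_def)
next
  case False
  show ?thesis
  proof (cases "0 < u")
    case True
    have "((\<lambda>u::real. u\<^sup>2) has_real_derivative 2 * max 0 u) (at u)"
      using True by (auto intro!: derivative_eq_intros)
    then show ?thesis
      by (rule has_field_derivative_transform_within_open[where S = "{0<..}"]) (use True in auto)
  next
    case f: False
    have "((\<lambda>u::real. 0) has_real_derivative 2 * max 0 u) (at u)"
      using False f by (auto intro!: derivative_eq_intros)
    then show ?thesis
      by (rule has_field_derivative_transform_within_open[where S = "{..<0}"]) (use False f in auto)
  qed
qed

definition bump :: "'a::euclidean_space \<Rightarrow> real" where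
  "bump y = max 0 (1 - y \<bullet> y)"

lemma bump_nonneg: "0 \<le> bump y"
  and bump_le_1: "bump y \<le> 1"
  and bump_eq_0: "y \<notin> cball 0 1 \<Longrightarrow> bump y = 0"
  by (auto simp: bump_def dot_square_norm abs_square_le_1 power_le_one_iff not_le)

lemma continuous_on_bump: "continuous_on A bump"
  unfolding bump_def by (intro continuous_intros)

lemma integral_bump_pos: "0 < integral\<^sup>L lborel (bump :: 'a::euclidean_space \<Rightarrow> real)"
proof -
  have "0 < measure lborel (cball (0::'a) (1/2)) * (1/2)"
    by (simp add: content_cball_pos)
  also have "\<dots> = integral\<^sup>L lborel (\<lambda>y::'a. indicator (cball 0 (1/2)) y *\<^sub>R (1/2))"
    by simp
  also have "\<dots> \<le> integral\<^sup>L lborel (bump :: 'a \<Rightarrow> real)"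
  proof (rule integral_mono)
    show "integrable lborel (\<lambda>y::'a. indicator (cball 0 (1/2)) y *\<^sub>R (1/2))"
      by (intro integrable_real_indicator integrable_scaleR_left)
        (auto simp: emeasure_lborel_cball_finite[unfolded infinity_ennreal_def])
    show "integrable lborel (bump :: 'a \<Rightarrow> real)"
      using continuous_on_bump bump_eq_0 by (rule integrable_lborel_continuous_support)
    fix y :: 'a
    show "indicator (cball 0 (1/2)) y *\<^sub>R (1/2) \<le> bump y"
    proof (cases "y \<in> cball 0 (1/2)")
      case True
      then have "(norm y)\<^sup>2 \<le> (1/2)\<^sup>2" by (intro power_mono) auto
      then show ?thesis using True by (simp add: bump_def dot_square_norm power2_eq_square)
    qed (simp add: bump_nonneg)
  qed
  finally show ?thesis .
qed

text \<open>The vector field \<open>bump y *\<^sub>R y\<close> is a constant multiple of the gradient of \<open>(bump y)\<^sup>2\<close>;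
  integrating by parts moves a second derivative onto \<open>f\<close>.\<close>

lemma integral_bump_radial_derivative:
  fixes f :: "'a::euclidean_space \<Rightarrow> real"
  assumes "open S" "harmonic_on S f" "0 \<le> r" "cball z r \<subseteq> S"
  shows "integral\<^sup>L lborel (\<lambda>y. bump y * (\<Sum>b\<in>Basis. (y \<bullet> b) * partial b f (z + r *\<^sub>R y))) = 0"
proof -
  define T where "T = {y. z + r *\<^sub>R y \<in> S}"
  have "open T"
    unfolding T_def vimage_def[symmetric] using assms(1) by (intro open_vimage continuous_intros)
  have T: "cball 0 1 \<subseteq> T"
  proof
    fix y :: 'a assume "y \<in> cball 0 1"
    then have "norm (r *\<^sub>R y) \<le> r" using assms(3) by (simp add: mult_left_le)
    then show "y \<in> T" using assms(4) by (auto simp: T_def dist_norm)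
  qed
  have bump0: "bump y = 0" if "y \<notin> T" for y using that T bump_eq_0 by blast
  have C2: "C2_on S f" using assms(2) by (simp add: harmonic_on_def)
  \<comment> \<open>The derivative in direction \<open>b\<close> of
    \<open>(bump y)\<^sup>2 * partial b f (z + r *\<^sub>R y)\<close>. Summed over \<open>b\<close>,
    the first part carries the Laplacian and vanishes, and the second is -4 times the integrand of
    the claim.\<close>
  define g' where "g' b y = (bump y)\<^sup>2 * (r * partial b (partial b f) (z + r *\<^sub>R y)) +
    bump y * (- 4 * (y \<bullet> b) * partial b f (z + r *\<^sub>R y))" for b y
  have comp: "continuous_on T (\<lambda>y. h (z + r *\<^sub>R y))" if "continuous_on S h" for h :: "'a \<Rightarrow> real"
    by (rule continuous_on_compose2[OF that]) (auto simp: T_def intro!: continuous_intros)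
  have ext: "continuous_on UNIV (\<lambda>y. \<phi> y * u y)"
    if "continuous_on T u" "continuous_on UNIV \<phi>" "\<And>y. y \<notin> cball 0 1 \<Longrightarrow> \<phi> y = 0"
    for u \<phi> :: "'a \<Rightarrow> real"
    by (rule continuous_on_mult_extend_zero[OF \<open>open T\<close>, where K = "cball 0 1"]) (use that T in auto)
  have C1b: "C1_on S (partial b f)" "continuous_on S (partial b f)"
    "continuous_on S (partial b (partial b f))" if "b \<in> Basis" for b
    using C2 that by (auto simp: C2_on_def C1_on_def)
  have cg': "continuous_on UNIV (g' b)" if "b \<in> Basis" for b
    unfolding g'_def using C1b[OF that]
    by (intro continuous_on_add ext continuous_intros comp continuous_on_bump) (auto simp: bump_eq_0)
  have int0: "integral\<^sup>L lborel (g' b) = 0" if b: "b \<in> Basis" for b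
  proof (rule integral_directional_derivative_eq_0)
    show "continuous_on UNIV (\<lambda>y. (bump y)\<^sup>2 * partial b f (z + r *\<^sub>R y))"
      using C1b[OF that] by (intro ext continuous_intros comp continuous_on_bump) (auto simp: bump_eq_0)
    show "(bump y)\<^sup>2 * partial b f (z + r *\<^sub>R y) = 0" if "y \<notin> cball 0 1" for y :: 'a
      using bump_eq_0[OF that] by simp
    show "((\<lambda>s. (bump (y + s *\<^sub>R b))\<^sup>2 * partial b f (z + r *\<^sub>R (y + s *\<^sub>R b)))
        has_real_derivative g' b y) (at 0)" for y
    proof (cases "y \<in> T")
      case True
      have "((\<lambda>s. 1 - (y + s *\<^sub>R b) \<bullet> (y + s *\<^sub>R b)) has_real_derivative - 2 * (y \<bullet> b)) (at 0)"
        by (auto intro!: derivative_eq_intros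
            simp: inner_add_left inner_add_right inner_commute algebra_simps)
      from DERIV_chain2[OF has_real_derivative_pos_part_square this]
      have 1: "((\<lambda>s. (bump (y + s *\<^sub>R b))\<^sup>2) has_real_derivative - 4 * (y \<bullet> b) * bump y) (at 0)"
        by (simp add: bump_def mult.commute mult.left_commute)
      have "has_partial b (partial b f) (z + r *\<^sub>R y)"
        using True C1b(1)[OF b] b by (auto simp: T_def C1_on_def)
      from has_partialD[of b "partial b f" "z + r *\<^sub>R y" 0] this
      have "((\<lambda>h. partial b f (z + r *\<^sub>R y + h *\<^sub>R b)) has_real_derivative
          partial b (partial b f) (z + r *\<^sub>R y)) (at (r * 0))" by simp
      from DERIV_chain2[OF this DERIV_cmult_Id]
      have 2: "((\<lambda>s. partial b f (z + r *\<^sub>R (y + s *\<^sub>R b))) has_real_derivative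
          partial b (partial b f) (z + r *\<^sub>R y) * r) (at 0)"
        by (simp add: algebra_simps)
      show ?thesis using DERIV_mult[OF 1 2] by (simp add: g'_def algebra_simps)
    next
      case False
      \<comment> \<open>Off the closed unit ball the product is 0 on a whole neighbourhood, whatever
        values \<open>partial b f\<close> takes there.\<close>
      then have "y \<notin> cball 0 1" using T by auto
      then have "0 \<in> (\<lambda>s::real. y + s *\<^sub>R b) -` (- cball 0 1)" by simp
      moreover have "open ((\<lambda>s::real. y + s *\<^sub>R b) -` (- cball 0 1))"
        by (intro open_vimage continuous_intros) auto
      ultimately have "\<forall>\<^sub>F s in nhds (0::real). y + s *\<^sub>R b \<in> - cball 0 1"
        using eventually_nhds_in_open by fastforce
      then have "\<forall>\<^sub>F s in nhds (0::real). (bump (y + s *\<^sub>R b))\<^sup>2 * partial b f (z + r *\<^sub>R (y + s *\<^sub>R b)) = 0"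
        by eventually_elim (simp add: bump_eq_0)
      from DERIV_cong_ev[OF refl this refl] show ?thesis
        using bump0[OF False] by (simp add: g'_def)
    qed
  qed (rule cg'[OF that])
  have intg: "integrable lborel (g' b)" if "b \<in> Basis" for b
    by (rule integrable_lborel_continuous_support[OF cg'[OF that], of 1]) (simp add: g'_def bump_eq_0)
  have "(\<Sum>b\<in>Basis. g' b y) =
      -4 * (bump y * (\<Sum>b\<in>Basis. (y \<bullet> b) * partial b f (z + r *\<^sub>R y)))" for y
  proof (cases "y \<in> T")
    case True
    then have "(\<Sum>b\<in>Basis. partial b (partial b f) (z + r *\<^sub>R y)) = 0"
      using assms(2) by (auto simp: harmonic_on_def laplacian_def T_def)
    moreover have "(\<Sum>b\<in>Basis. g' b y) =
        (bump y)\<^sup>2 * r * (\<Sum>b\<in>Basis. partial b (partial b f) (z + r *\<^sub>R y)) -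
        4 * bump y * (\<Sum>b\<in>Basis. (y \<bullet> b) * partial b f (z + r *\<^sub>R y))"
      by (simp add: g'_def sum_subtractf sum_distrib_left mult.assoc mult.left_commute)
    ultimately show ?thesis by simp
  qed (simp add: g'_def bump0)
  then have "(\<integral>y. -4 * (bump y * (\<Sum>b\<in>Basis. (y \<bullet> b) * partial b f (z + r *\<^sub>R y))) \<partial>lborel) =
      (\<integral>y. (\<Sum>b\<in>Basis. g' b y) \<partial>lborel)" by simp
  also have "\<dots> = 0" using intg int0 by simp
  finally show ?thesis by simp
qed

lemma inner_One: "i \<in> Basis \<Longrightarrow> One \<bullet> i = 1"
  using inner_sum_left_Basis[of i "\<lambda>_. 1"] by simp

text \<open>Differentiation under the integral sign takes place over a compact box, integration by
  parts over the whole space. For functions supported in the unit ball the two integrals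
  agree.\<close>

lemma integral_cbox_eq_lborel:
  fixes g :: "'a::euclidean_space \<Rightarrow> real"
  assumes "continuous_on UNIV g" "\<And>y. y \<notin> cball 0 1 \<Longrightarrow> g y = 0"
  shows "integral (cbox (- One) One) g = integral\<^sup>L lborel g"
proof -
  have "cball 0 1 \<subseteq> cbox (- One) (One :: 'a)"
    using order.trans[OF Basis_le_norm] by (fastforce simp: mem_box inner_One abs_le_iff)
  then have "g y = 0" if "y \<notin> cbox (- One) One" for y
    using assms(2)[of y] that by blast
  then have "(\<lambda>y. if y \<in> cbox (- One) One then g y else 0) = g"
    by auto
  then have "integral (cbox (- One) One) g = integral UNIV g"
    using integral_restrict_UNIV[of "cbox (- One) One" g] by simp
  then show ?thesis
    using integral_lborel[OF integrable_lborel_continuous_support[OF assms]] by simp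
qed

lemma harmonic_mean_value:
  fixes f :: "'a::euclidean_space \<Rightarrow> real"
  assumes "open S" "harmonic_on S f" "0 < r" "cball z r \<subseteq> S"
  shows "integrable lborel (\<lambda>y. bump y * f (z + r *\<^sub>R y))"
    and "integral\<^sup>L lborel (\<lambda>y. bump y * f (z + r *\<^sub>R y)) = f z * integral\<^sup>L lborel (bump :: 'a \<Rightarrow> real)"
proof -
  \<comment> \<open>Differentiating under the integral needs continuity in radius and direction
    jointly, so the extension by zero is made on the strip \<open>{0..r} \<times> UNIV\<close> and
    not for each radius separately.\<close>
  define T where "T = {(\<rho>, y). z + \<rho> *\<^sub>R y \<in> S}"
  have T_eq: "T = (\<lambda>p. z + fst p *\<^sub>R snd p) -` S" by (auto simp: T_def)
  have "open T"
    unfolding T_eq using assms(1) by (intro open_vimage continuous_intros)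
  have in_S: "z + \<rho> *\<^sub>R y \<in> S" if "\<rho> \<in> {0..r}" "norm y \<le> 1" for \<rho> y
  proof -
    have "norm (\<rho> *\<^sub>R y) \<le> r * 1" using that unfolding norm_scaleR by (intro mult_mono) auto
    then show ?thesis using assms(4) by (auto simp: dist_norm)
  qed
  have C1: "C1_on S f" using assms(2) by (simp add: harmonic_on_def C2_on_def)
  define G where "G \<rho> y = (\<Sum>b\<in>Basis. (y \<bullet> b) * partial b f (z + \<rho> *\<^sub>R y))" for \<rho> y
  have comp: "continuous_on T (\<lambda>p. h (z + fst p *\<^sub>R snd p))" if "continuous_on S h" for h :: "'a \<Rightarrow> real"
    by (rule continuous_on_compose2[OF that]) (auto simp: T_def intro!: continuous_intros)
  have ext: "continuous_on ({0..r} \<times> UNIV) (\<lambda>p. bump (snd p) * u p)"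
    if "continuous_on T u" for u :: "real \<times> 'a \<Rightarrow> real"
  proof (rule continuous_on_mult_extend_zero[OF \<open>open T\<close>])
    show "closed (UNIV \<times> cball (0::'a) 1)" by (intro closed_Times) auto
    show "continuous_on ({0..r} \<times> UNIV) (\<lambda>p::real \<times> 'a. bump (snd p))"
      unfolding bump_def by (intro continuous_intros)
  qed (use that in_S bump_eq_0 in \<open>fastforce simp: T_def intro: continuous_on_subset\<close>)+
  have cF: "continuous_on ({0..r} \<times> UNIV) (\<lambda>p. bump (snd p) * f (z + fst p *\<^sub>R snd p))"
    using C1 by (intro ext comp) (simp add: C1_on_def)
  have cG: "continuous_on ({0..r} \<times> UNIV) (\<lambda>p. bump (snd p) * G (fst p) (snd p))"
    unfolding G_def using C1 by (intro ext continuous_intros comp) (simp add: C1_on_def)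
  have slice: "continuous_on UNIV (\<lambda>y. h (\<rho>, y))" if "continuous_on ({0..r} \<times> UNIV) h" "\<rho> \<in> {0..r}"
    for h :: "real \<times> 'a \<Rightarrow> real" and \<rho>
    by (rule continuous_on_compose2[OF that(1)]) (use that(2) in \<open>auto intro!: continuous_intros\<close>)
  have F\<rho>: "continuous_on UNIV (\<lambda>y. bump y * f (z + \<rho> *\<^sub>R y))" if "\<rho> \<in> {0..r}" for \<rho>
    using slice[OF cF that] by simp
  have G\<rho>: "continuous_on UNIV (\<lambda>y. bump y * G \<rho> y)" if "\<rho> \<in> {0..r}" for \<rho>
    using slice[OF cG that] by simp
  show "integrable lborel (\<lambda>y. bump y * f (z + r *\<^sub>R y))"
    by (rule integrable_lborel_continuous_support[OF F\<rho>, of _ 1]) (use assms(3) in \<open>auto simp: bump_eq_0\<close>)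
  let ?Q = "cbox (- One) (One::'a)"
  define F where "F \<rho> = integral ?Q (\<lambda>y. bump y * f (z + \<rho> *\<^sub>R y))" for \<rho>
  have "(F has_field_derivative 0) (at \<rho> within {0..r})" if \<rho>: "\<rho> \<in> {0..r}" for \<rho>
  proof -
    have "(F has_field_derivative integral ?Q (\<lambda>y. bump y * G \<rho> y)) (at \<rho> within {0..r})"
      unfolding F_def
    proof (rule leibniz_rule_field_derivative[where fx = "\<lambda>\<rho> y. bump y * G \<rho> y"])
      fix \<rho> and y :: 'a assume \<rho>: "\<rho> \<in> {0..r}"
      show "((\<lambda>\<rho>. bump y * f (z + \<rho> *\<^sub>R y)) has_field_derivative bump y * G \<rho> y) (at \<rho> within {0..r})"
      proof (cases "norm y \<le> 1")
        case True
        from C1_on_has_derivative[OF assms(1) C1 in_S[OF \<rho> True]]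
        have "(f has_derivative (\<lambda>h. \<Sum>b\<in>Basis. (h \<bullet> b) * partial b f (z + \<rho> *\<^sub>R y))) (at (z + \<rho> *\<^sub>R y))" .
        moreover have "((\<lambda>\<rho>. z + \<rho> *\<^sub>R y) has_derivative (\<lambda>h. h *\<^sub>R y)) (at \<rho>)"
          by (auto intro!: derivative_eq_intros)
        ultimately have "((\<lambda>\<rho>. f (z + \<rho> *\<^sub>R y)) has_derivative
            (\<lambda>h. \<Sum>b\<in>Basis. ((h *\<^sub>R y) \<bullet> b) * partial b f (z + \<rho> *\<^sub>R y))) (at \<rho>)"
          using has_derivative_compose[of "\<lambda>\<rho>. z + \<rho> *\<^sub>R y" _ \<rho> UNIV f] by fastforce
        then have "((\<lambda>\<rho>. f (z + \<rho> *\<^sub>R y)) has_field_derivative G \<rho> y) (at \<rho>)"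
          unfolding has_field_derivative_def G_def
          by (rule has_derivative_eq_rhs) (auto simp: sum_distrib_left algebra_simps fun_eq_iff)
        then show ?thesis
          by (intro DERIV_cmult) (rule has_field_derivative_at_within)
      qed (simp add: bump_eq_0)
    next
      fix \<rho> assume "\<rho> \<in> {0..r}"
      then show "(\<lambda>y. bump y * f (z + \<rho> *\<^sub>R y)) integrable_on ?Q"
        using F\<rho> by (intro integrable_continuous) (auto intro: continuous_on_subset)
    next
      show "continuous_on ({0..r} \<times> ?Q) (\<lambda>(\<rho>, y). bump y * G \<rho> y)"
        unfolding split_beta by (rule continuous_on_subset[OF cG]) auto
    qed (use \<rho> in auto)
    also have "integral ?Q (\<lambda>y. bump y * G \<rho> y) = integral\<^sup>L lborel (\<lambda>y. bump y * G \<rho> y)"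
      using G\<rho>[OF \<rho>] by (rule integral_cbox_eq_lborel) (simp add: bump_eq_0)
    also have "\<dots> = 0"
      unfolding G_def
      by (rule integral_bump_radial_derivative[OF assms(1,2)]) (use \<rho> assms(4) in auto)
    finally show ?thesis .
  qed
  then obtain c where "\<And>\<rho>. \<rho> \<in> {0..r} \<Longrightarrow> F \<rho> = c"
    using has_field_derivative_zero_constant[of "{0..r}" F] by auto
  \<comment> \<open>At radius 0 the argument of \<open>f\<close> is constantly \<open>z\<close>, so
    \<open>F 0\<close> is \<open>f z\<close> times the integral of \<open>bump\<close>.\<close>
  then have "F r = F 0" using assms(3) by simp
  moreover have "F \<rho> = integral\<^sup>L lborel (\<lambda>y. bump y * f (z + \<rho> *\<^sub>R y))" if "\<rho> \<in> {0..r}" for \<rho>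
    unfolding F_def using F\<rho>[OF that] by (rule integral_cbox_eq_lborel) (simp add: bump_eq_0)
  ultimately show "integral\<^sup>L lborel (\<lambda>y. bump y * f (z + r *\<^sub>R y)) = f z * integral\<^sup>L lborel (bump :: 'a \<Rightarrow> real)"
    using assms(3) by (simp add: mult.commute)
qed

section \<open>Local integral estimates\<close>

lemma borel_measurable_ennreal_indicator:
  fixes g :: "'a::euclidean_space \<Rightarrow> real"
  assumes "closed A" "continuous_on A g"
  shows "(\<lambda>x. ennreal (g x) * indicator A x) \<in> borel_measurable borel"
proof -
  have [measurable]: "(\<lambda>x. indicator A x *\<^sub>R g x) \<in> borel_measurable borel"
    using assms by (intro borel_measurable_continuous_on_indicator) auto
  have "(\<lambda>x. ennreal (indicator A x *\<^sub>R g x)) \<in> borel_measurable borel" by measurable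
  also have "(\<lambda>x. ennreal (indicator A x *\<^sub>R g x)) = (\<lambda>x. ennreal (g x) * indicator A x)"
    by (auto simp: indicator_def)
  finally show ?thesis .
qed

lemma nn_integral_lborel_affine:
  fixes h :: "'a::euclidean_space \<Rightarrow> ennreal"
  assumes [measurable]: "h \<in> borel_measurable borel" and "0 < r"
  shows "(\<integral>\<^sup>+x. h x \<partial>lborel) = ennreal (r ^ DIM('a)) * (\<integral>\<^sup>+y. h (z + r *\<^sub>R y) \<partial>lborel)"
  using assms(2)
  by (subst lborel_affine[of r z], simp, subst nn_integral_density)
    (auto simp: nn_integral_distr nn_integral_cmult abs_of_pos)

text \<open>The weight lies between 0 and 1 and is supported in the unit ball, so the mean value
  identity becomes an upper bound; \<open>r ^ DIM('a)\<close> is the Jacobian of the map from the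
  unit ball to \<open>cball z r\<close>. By the order of the quantifiers the constant depends only
  on the dimension.\<close>

lemma harmonic_abs_le_average:
  "\<exists>C>0. \<forall>S (f :: 'a::euclidean_space \<Rightarrow> real) z r. open S \<longrightarrow> harmonic_on S f \<longrightarrow> 0 < r \<longrightarrow>
     cball z r \<subseteq> S \<longrightarrow>
     ennreal (\<bar>f z\<bar> * r ^ DIM('a)) \<le> ennreal C * (\<integral>\<^sup>+x\<in>cball z r. ennreal \<bar>f x\<bar> \<partial>lborel)"
proof (intro exI[of _ "1 / integral\<^sup>L lborel (bump :: 'a \<Rightarrow> real)"] conjI allI impI)
  let ?c = "integral\<^sup>L lborel (bump :: 'a \<Rightarrow> real)"
  show "0 < 1 / ?c" using integral_bump_pos by simp
  fix S and f :: "'a \<Rightarrow> real" and z r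
  assume S: "open S" "harmonic_on S f" "0 < r" "cball z r \<subseteq> S"
  have "continuous_on S f" using S(2) by (simp add: harmonic_on_def C2_on_def C1_on_def)
  then have "continuous_on (cball z r) (\<lambda>x. \<bar>f x\<bar>)"
    using S(4) by (auto intro!: continuous_intros intro: continuous_on_subset)
  from borel_measurable_ennreal_indicator[OF closed_cball this]
  have meas: "(\<lambda>x. ennreal \<bar>f x\<bar> * indicator (cball z r) x) \<in> borel_measurable borel" .
  have "ennreal (\<bar>f z\<bar> * ?c) = ennreal (norm (\<integral>y. bump y * f (z + r *\<^sub>R y) \<partial>lborel))"
    using harmonic_mean_value(2)[OF S] integral_bump_pos[where 'a = 'a] by (simp add: abs_mult)
  also have "\<dots> \<le> (\<integral>\<^sup>+y. norm (bump y * f (z + r *\<^sub>R y)) \<partial>lborel)"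
    using harmonic_mean_value(1)[OF S] by (rule integral_norm_bound_ennreal)
  also have "\<dots> \<le> (\<integral>\<^sup>+y. ennreal \<bar>f (z + r *\<^sub>R y)\<bar> * indicator (cball z r) (z + r *\<^sub>R y) \<partial>lborel)"
  proof (rule nn_integral_mono)
    fix y :: 'a
    show "ennreal (norm (bump y * f (z + r *\<^sub>R y))) \<le>
        ennreal \<bar>f (z + r *\<^sub>R y)\<bar> * indicator (cball z r) (z + r *\<^sub>R y)"
      using bump_eq_0[of y] bump_nonneg[of y] bump_le_1[of y] S(3)
      by (cases "norm y \<le> 1")
        (auto simp: abs_mult dist_norm indicator_def intro!: ennreal_leI intro: mult_left_le_one_le)
  qed
  finally have le: "ennreal (\<bar>f z\<bar> * ?c) \<le> \<dots>" .
  have "ennreal (\<bar>f z\<bar> * r ^ DIM('a)) = ennreal (1 / ?c) * (ennreal (r ^ DIM('a)) * ennreal (\<bar>f z\<bar> * ?c))"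
    using integral_bump_pos[where 'a = 'a] S(3) by (simp flip: ennreal_mult' add: field_simps)
  also have "\<dots> \<le> ennreal (1 / ?c) * (\<integral>\<^sup>+x\<in>cball z r. ennreal \<bar>f x\<bar> \<partial>lborel)"
    unfolding nn_integral_lborel_affine[OF meas S(3), of z] by (intro mult_left_mono le) auto
  finally show "ennreal (\<bar>f z\<bar> * r ^ DIM('a)) \<le>
    ennreal (1 / ?c) * (\<integral>\<^sup>+x\<in>cball z r. ennreal \<bar>f x\<bar> \<partial>lborel)" .
qed

section \<open>Sub-mean-value inequality for every positive exponent\<close>

text \<open>With \<open>t = a / A\<close>, either \<open>t \<le> \<epsilon>\<close> and the linear
  term suffices, or t lies between \<epsilon> and \<open>K\<close>. In that case \<open>a = t powr
  (1 - \<sigma>) * A powr (1 - \<sigma>) * a powr \<sigma>\<close>, and the power of t is at most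
  its value at \<open>K\<close> or at \<epsilon>, depending on the sign of 1 - \<sigma>. This treats
  small and large \<sigma> alike, and the linear term is small enough to be absorbed later.\<close>

lemma le_linear_plus_powr:
  fixes a A K \<epsilon> \<sigma> :: real
  assumes "0 \<le> a" "a \<le> K * A" "0 < A" "0 < \<epsilon>" "0 < \<sigma>"
  shows "a \<le> \<epsilon> * A + (K powr (1 - \<sigma>) + \<epsilon> powr (1 - \<sigma>)) * A powr (1 - \<sigma>) * a powr \<sigma>"
proof (cases "a \<le> \<epsilon> * A")
  case True
  then show ?thesis by (simp add: add_increasing2)
next
  case False
  then have "0 < a" using mult_pos_pos[OF assms(4,3)] by linarith
  define t where "t = a / A"
  have a: "a = t * A" and t: "\<epsilon> < t" "t \<le> K" "0 < t"
    using False assms \<open>0 < a\<close> by (simp_all add: t_def pos_less_divide_eq pos_divide_le_eq)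
  have "t powr (1 - \<sigma>) \<le> K powr (1 - \<sigma>) + \<epsilon> powr (1 - \<sigma>)"
  proof (cases "\<sigma> \<le> 1")
    case True
    then have "t powr (1 - \<sigma>) \<le> K powr (1 - \<sigma>)" using t by (intro powr_mono2) auto
    then show ?thesis by (simp add: add_increasing2)
  next
    case False
    then have "t powr (1 - \<sigma>) \<le> \<epsilon> powr (1 - \<sigma>)" using t assms by (intro powr_mono2') auto
    then show ?thesis by (simp add: add_increasing)
  qed
  then have "t powr (1 - \<sigma>) * (A powr (1 - \<sigma>) * a powr \<sigma>) \<le>
      (K powr (1 - \<sigma>) + \<epsilon> powr (1 - \<sigma>)) * (A powr (1 - \<sigma>) * a powr \<sigma>)"
    by (intro mult_right_mono) auto
  moreover have "t powr (1 - \<sigma>) * (A powr (1 - \<sigma>) * a powr \<sigma>) = a"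
    using t assms(3) by (simp add: a powr_mult powr_diff)
  ultimately show ?thesis using mult_pos_pos[OF assms(4,3)] by (simp add: mult.assoc)
qed

text \<open>For \<open>\<sigma> < 1\<close> the mean value property alone is not enough. At a maximiser \<open>x\<close> of
  \<open>(r - dist z x) powr (d / \<sigma>) * \<bar>f x\<bar>\<close> the values of \<open>\<bar>f\<bar>\<close> on a ball of comparable radius around \<open>x\<close>
  are bounded by a multiple of \<open>\<bar>f x\<bar>\<close>, so the averages of \<open>\<bar>f\<bar>\<close> and \<open>\<bar>f\<bar> powr \<sigma>\<close> are comparable there.\<close>

lemma harmonic_powr_le_average:
  assumes "0 < \<sigma>"
  shows "\<exists>C>0. \<forall>S (f :: 'a::euclidean_space \<Rightarrow> real) z r. open S \<longrightarrow> harmonic_on S f \<longrightarrow> 0 < r \<longrightarrow>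
     cball z r \<subseteq> S \<longrightarrow>
     ennreal (\<bar>f z\<bar> powr \<sigma> * r ^ DIM('a)) \<le>
       ennreal C * (\<integral>\<^sup>+x\<in>cball z r. ennreal (\<bar>f x\<bar> powr \<sigma>) \<partial>lborel)"
proof -
  let ?d = "DIM('a)"
  obtain C where C: "0 < C" and avg: "\<And>S (f :: 'a \<Rightarrow> real) z r. open S \<Longrightarrow> harmonic_on S f \<Longrightarrow> 0 < r \<Longrightarrow>
     cball z r \<subseteq> S \<Longrightarrow>
     ennreal (\<bar>f z\<bar> * r ^ ?d) \<le> ennreal C * (\<integral>\<^sup>+x\<in>cball z r. ennreal \<bar>f x\<bar> \<partial>lborel)"
    using harmonic_abs_le_average[where 'a = 'a] by meson
  define V where "V = unit_ball_vol (real ?d)"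
  have V: "0 < V" unfolding V_def by (rule unit_ball_vol_pos) simp
  \<comment> \<open>With this value the linear term, integrated over the ball of radius
    \<open>\<delta> / 2\<close>, amounts to exactly half of the left side of the mean value
    estimate.\<close>
  define \<epsilon> where "\<epsilon> = 1 / (2 * C * V)"
  have \<epsilon>: "0 < \<epsilon>" using C V by (simp add: \<epsilon>_def)
  \<comment> \<open>Makes \<open>(\<delta> powr \<gamma> * A) powr \<sigma>\<close> equal to
    \<open>\<delta> ^ ?d * A powr \<sigma>\<close>, the quantity that an average over a ball of
    radius \<open>\<delta> / 2\<close> controls. \<open>K\<close> is the most that the weight loses
    when the distance to the sphere is halved.\<close>
  define \<gamma> where "\<gamma> = ?d / \<sigma>"
  have \<gamma>: "0 < \<gamma>" using assms by (simp add: \<gamma>_def)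
  define K where "K = (2::real) powr \<gamma>"
  define K' where "K' = K powr (1 - \<sigma>) + \<epsilon> powr (1 - \<sigma>)"
  have K': "0 < K'" using \<epsilon> by (simp add: K'_def K_def add_pos_pos)
  define C' where "C' = 2 ^ (?d + 1) * C * K'"
  show ?thesis
  proof (intro exI[of _ C'] conjI allI impI)
    show "0 < C'" using C K' by (simp add: C'_def)
    fix S and f :: "'a \<Rightarrow> real" and z r
    assume S: "open S" "harmonic_on S f" "0 < r" "cball z r \<subseteq> S"
    define J where "J = (\<lambda>B. \<integral>\<^sup>+x\<in>B. ennreal (\<bar>f x\<bar> powr \<sigma>) \<partial>lborel)"
    have "ennreal (\<bar>f z\<bar> powr \<sigma> * r ^ ?d) \<le> ennreal C' * J (cball z r)"
    proof (cases "f z = 0")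
      case False
      have contf: "continuous_on S f" using S(2) by (simp add: harmonic_on_def C2_on_def C1_on_def)
      define g where "g x = (r - dist z x) powr \<gamma> * \<bar>f x\<bar>" for x
      have "continuous_on (cball z r) g"
        unfolding g_def using \<gamma> S(4) contf
        by (auto intro!: continuous_intros continuous_on_powr' intro: continuous_on_subset)
      then obtain x where x: "x \<in> cball z r" "\<And>y. y \<in> cball z r \<Longrightarrow> g y \<le> g x"
        using continuous_attains_sup[of "cball z r" g] S(3) by auto
      define A where "A = \<bar>f x\<bar>"
      define \<delta> where "\<delta> = r - dist z x"
      have gz: "g z = r powr \<gamma> * \<bar>f z\<bar>" by (simp add: g_def)
      then have "0 < g z" using False S(3) by simp
      also have gzx: "g z \<le> g x" using x S(3) by simp
      finally have "0 < g x" .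
      then have A: "0 < A" and "\<delta> \<noteq> 0" by (auto simp: g_def A_def \<delta>_def)
      then have \<delta>: "0 < \<delta>" using x(1) by (auto simp: \<delta>_def)
      define B where "B = cball x (\<delta> / 2)"
      have B_dist: "\<delta> / 2 \<le> r - dist z y" if "y \<in> B" for y
        using that dist_triangle[of z y x] by (simp add: B_def \<delta>_def)
      then have Bz: "B \<subseteq> cball z r" using \<delta> by force
      have fB: "\<bar>f y\<bar> \<le> K * A" if "y \<in> B" for y
      proof -
        have "(\<delta> / 2) powr \<gamma> * \<bar>f y\<bar> \<le> g y"
          unfolding g_def using B_dist[OF that] \<delta> \<gamma> by (intro mult_right_mono powr_mono2) auto
        also have "\<dots> \<le> \<delta> powr \<gamma> * A"
          using x(2)[of y] that Bz by (auto simp: g_def A_def \<delta>_def)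
        finally have "\<delta> powr \<gamma> * \<bar>f y\<bar> \<le> \<delta> powr \<gamma> * (K * A)"
          using \<delta> by (simp add: K_def powr_divide field_simps)
        then show ?thesis using \<delta> by simp
      qed
      have mono: "J B \<le> J (cball z r)"
        unfolding J_def using Bz by (intro nn_integral_mono mult_left_mono) (auto simp: indicator_def)
      show ?thesis
      \<comment> \<open>Absorbing half of the left side is a subtraction and takes place in the
        reals; an infinite integral makes the claim trivial.\<close>
      proof (cases "J B = top")
        case True
        then show ?thesis using mono \<open>0 < C'\<close> by (simp add: top_unique ennreal_mult_top)
      next
        case fin: False
        define j where "j = enn2real (J B)"
        have j: "J B = ennreal j" "0 \<le> j" using fin by (auto simp: j_def less_top)
        have "continuous_on B (\<lambda>y. \<bar>f y\<bar> powr \<sigma>)"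
          using contf Bz S(4) assms
          by (auto intro!: continuous_intros continuous_on_powr' intro: continuous_on_subset)
        from borel_measurable_ennreal_indicator[OF _ this]
        have [measurable]: "(\<lambda>y. ennreal (\<bar>f y\<bar> powr \<sigma>) * indicator B y) \<in> borel_measurable borel"
          by (simp add: B_def)
        have [measurable]: "B \<in> sets borel" by (simp add: B_def)
        define D where "D = K' * A powr (1 - \<sigma>)"
        have D: "0 < D" using K' A by (simp add: D_def)
        have eB: "emeasure lborel B = ennreal (V * (\<delta> / 2) ^ ?d)"
          using \<delta> by (simp add: B_def emeasure_cball V_def)
        have "ennreal (A * (\<delta> / 2) ^ ?d) \<le> ennreal C * (\<integral>\<^sup>+y\<in>B. ennreal \<bar>f y\<bar> \<partial>lborel)"
          unfolding A_def B_def
          by (rule avg[OF S(1,2)]) (use \<delta> order.trans[OF Bz S(4)] in \<open>simp_all add: B_def\<close>)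
        also have "\<dots> \<le> ennreal C * (\<integral>\<^sup>+y. (ennreal (\<epsilon> * A) * indicator B y +
            ennreal D * (ennreal (\<bar>f y\<bar> powr \<sigma>) * indicator B y)) \<partial>lborel)"
        proof (intro mult_left_mono nn_integral_mono)
          fix y
          show "ennreal \<bar>f y\<bar> * indicator B y \<le> ennreal (\<epsilon> * A) * indicator B y +
            ennreal D * (ennreal (\<bar>f y\<bar> powr \<sigma>) * indicator B y)"
          proof (cases "y \<in> B")
            case True
            have "\<bar>f y\<bar> \<le> \<epsilon> * A + D * \<bar>f y\<bar> powr \<sigma>"
              unfolding D_def K'_def using A \<epsilon> assms fB[OF True] by (intro le_linear_plus_powr) auto
            then show ?thesis
              using True A \<epsilon> D by (simp flip: ennreal_mult' ennreal_plus)
          qed simp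
        qed simp
        also have "\<dots> = ennreal C * (ennreal (\<epsilon> * A) * emeasure lborel B + ennreal D * J B)"
          unfolding J_def by (simp add: nn_integral_add nn_integral_cmult)
        also have "\<dots> = ennreal (C * (\<epsilon> * A * (V * (\<delta> / 2) ^ ?d) + D * j))"
          unfolding eB j(1) using C \<epsilon> A V \<delta> D j(2) by (simp flip: ennreal_mult' ennreal_plus)
        finally have "A * (\<delta> / 2) ^ ?d \<le> C * (\<epsilon> * A * (V * (\<delta> / 2) ^ ?d) + D * j)"
          using C \<epsilon> A V \<delta> D j(2) by (subst (asm) ennreal_le_iff) auto
        also have "\<dots> = A * (\<delta> / 2) ^ ?d / 2 + C * D * j"
          using C V by (simp add: \<epsilon>_def field_simps)
        finally have "A * \<delta> ^ ?d \<le> 2 ^ (?d + 1) * C * D * j"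
          by (simp add: power_divide field_simps)
        \<comment> \<open>This factor produces \<open>A powr \<sigma>\<close> on the left and
          cancels the \<open>A powr (1 - \<sigma>)\<close> contained in \<open>D\<close>, so that
          \<open>A\<close> disappears from the right side.\<close>
        then have "A powr (\<sigma> - 1) * (A * \<delta> ^ ?d) \<le> A powr (\<sigma> - 1) * (2 ^ (?d + 1) * C * D * j)"
          by (intro mult_left_mono) auto
        moreover have "A powr (\<sigma> - 1) * (A * \<delta> ^ ?d) = A powr \<sigma> * \<delta> ^ ?d"
          using A by (simp add: powr_diff)
        moreover have "A powr (\<sigma> - 1) * (2 ^ (?d + 1) * C * D * j) = C' * j"
        proof -
          have "A powr (\<sigma> - 1) * A powr (1 - \<sigma>) = 1" using A by (simp flip: powr_add)
          then have "A powr (\<sigma> - 1) * D = K'" by (simp add: D_def mult.left_commute)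
          then show ?thesis by (simp add: C'_def mult.commute mult.left_commute)
        qed
        ultimately have "A powr \<sigma> * \<delta> ^ ?d \<le> C' * j" by (simp only:)
        moreover have "r ^ ?d * \<bar>f z\<bar> powr \<sigma> \<le> \<delta> ^ ?d * A powr \<sigma>"
        proof -
          have "(r powr \<gamma> * \<bar>f z\<bar>) powr \<sigma> \<le> (\<delta> powr \<gamma> * A) powr \<sigma>"
            using gzx gz assms by (intro powr_mono2) (auto simp: g_def A_def \<delta>_def)
          then show ?thesis
            using S(3) \<delta> assms by (simp add: powr_mult powr_powr \<gamma>_def powr_realpow A_def)
        qed
        ultimately have "\<bar>f z\<bar> powr \<sigma> * r ^ ?d \<le> C' * j" by (simp add: mult.commute)
        then have "ennreal (\<bar>f z\<bar> powr \<sigma> * r ^ ?d) \<le> ennreal C' * J B"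
          using \<open>0 < C'\<close> j by (simp flip: ennreal_mult' add: ennreal_leI)
        also have "\<dots> \<le> ennreal C' * J (cball z r)" using mono by (intro mult_left_mono) auto
        finally show ?thesis .
      qed
    qed simp
    then show "ennreal (\<bar>f z\<bar> powr \<sigma> * r ^ ?d) \<le>
       ennreal C' * (\<integral>\<^sup>+x\<in>cball z r. ennreal (\<bar>f x\<bar> powr \<sigma>) \<partial>lborel)"
      by (simp add: J_def)
  qed
qed

section \<open>Negative powers of the distance, integrated away from the pole\<close>

text \<open>Dyadic shells: between the radii \<open>R j\<close> and \<open>R (Suc j)\<close> the
  integrand is at most \<open>R j powr - M\<close>. Enlarging each shell to the full ball leaves a
  geometric series with ratio \<theta>, which is less than 1 because \<open>M\<close> exceeds the
  dimension.\<close>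

lemma nn_integral_norm_powr_outside_ball:
  assumes "real DIM('a::euclidean_space) < M"
  shows "\<exists>C>0. \<forall>(a::'a) \<rho>. 0 < \<rho> \<longrightarrow>
    (\<integral>\<^sup>+u\<in>- ball a \<rho>. ennreal (norm (u - a) powr - M) \<partial>lborel) \<le> ennreal (C * \<rho> powr (real DIM('a) - M))"
proof -
  let ?d = "DIM('a)"
  define V where "V = unit_ball_vol (real ?d)"
  have V: "0 < V" unfolding V_def by (rule unit_ball_vol_pos) simp
  define \<theta> where "\<theta> = (2::real) powr (?d - M)"
  have \<theta>: "0 < \<theta>" "\<theta> < 1" using assms by (auto simp: \<theta>_def powr_less_one)
  define C where "C = V * 2 ^ ?d * (1 / (1 - \<theta>))"
  show ?thesis
  proof (intro exI[of _ C] conjI allI impI)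
    show "0 < C" using V \<theta> by (simp add: C_def)
    fix a :: 'a and \<rho> :: real assume \<rho>: "0 < \<rho>"
    define R where "R j = 2 ^ j * \<rho>" for j :: nat
    have R: "0 < R j" for j using \<rho> by (simp add: R_def)
    have 1: "(\<integral>\<^sup>+u\<in>- ball a \<rho>. ennreal (norm (u - a) powr - M) \<partial>lborel) \<le>
        (\<integral>\<^sup>+u. (\<Sum>j. ennreal (R j powr - M) * indicator (cball a (R (Suc j))) u) \<partial>lborel)"
    proof (intro nn_integral_mono)
      fix u
      show "ennreal (norm (u - a) powr - M) * indicator (- ball a \<rho>) u \<le>
          (\<Sum>j. ennreal (R j powr - M) * indicator (cball a (R (Suc j))) u)"
      proof (cases "u \<in> ball a \<rho>")
        case False
        then have far: "\<rho> \<le> norm (u - a)" by (simp add: dist_norm norm_minus_commute)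
        define h where "h j = ennreal (R j powr - M) * indicator (cball a (R (Suc j))) u" for j
        obtain n where "norm (u - a) / \<rho> < 2 ^ n"
          using real_arch_pow[of 2] by auto
        then have ex: "norm (u - a) < R n" using \<rho> by (simp add: R_def field_simps)
        \<comment> \<open>The first dyadic radius beyond the point. It is not the radius \<rho>
          itself because of \<open>far\<close>, and its predecessor \<open>j\<close> indexes the
          shell.\<close>
        define n0 where "n0 = (LEAST n. norm (u - a) < R n)"
        have n0: "norm (u - a) < R n0" unfolding n0_def using ex by (rule LeastI)
        with far have "n0 \<noteq> 0" by (intro notI) (simp add: R_def)
        then obtain j where j: "n0 = Suc j" using not0_implies_Suc by blast
        then have "R j \<le> norm (u - a)"
          using not_less_Least[of j "\<lambda>n. norm (u - a) < R n"] by (simp add: n0_def[symmetric])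
        then have "norm (u - a) powr - M \<le> R j powr - M"
          using assms R[of j] by (intro powr_mono2') auto
        then have "ennreal (norm (u - a) powr - M) \<le> ennreal (R j powr - M) * indicator (cball a (R (Suc j))) u"
          using n0 j by (auto simp: dist_norm norm_minus_commute intro: ennreal_leI)
        also have "\<dots> \<le> (\<Sum>j. ennreal (R j powr - M) * indicator (cball a (R (Suc j))) u)"
        proof -
          have "sum h {j} \<le> suminf h" by (rule sum_le_suminf) auto
          then have "h j \<le> suminf h" by simp
          then show ?thesis unfolding h_def .
        qed
        finally show ?thesis using False by simp
      qed simp
    qed
    have 2: "(\<integral>\<^sup>+u. (\<Sum>j. ennreal (R j powr - M) * indicator (cball a (R (Suc j))) u) \<partial>lborel) =
        (\<Sum>j. ennreal (R j powr - M) * emeasure lborel (cball a (R (Suc j))))"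
    proof -
      have cb: "cball a (R (Suc j)) \<in> sets lborel" for j by simp
      show ?thesis
        using nn_integral_suminf[of "\<lambda>j u. ennreal (R j powr - M) * indicator (cball a (R (Suc j))) u" lborel]
        by (simp only: nn_integral_cmult_indicator[OF cb] borel_measurable_times_ennreal
            borel_measurable_const borel_measurable_indicator[OF cb])
    qed
    have 3: "ennreal (R j powr - M) * emeasure lborel (cball a (R (Suc j))) =
        ennreal (V * 2 ^ ?d * \<rho> powr (?d - M) * \<theta> ^ j)" for j
    proof -
      have pw: "x ^ k = x powr real k" if "0 < x" for x :: real and k
        using powr_realpow[OF that, of k] by simp
      have 1: "R j powr - M * R j ^ ?d = R j powr (?d - M)"
        unfolding pw[OF R] powr_add[symmetric] by simp
      have "(2 ^ j :: real) powr (?d - M) = (2 powr real j) powr (?d - M)"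
        unfolding pw[OF zero_less_numeral] ..
      also have "\<dots> = \<theta> powr real j"
        unfolding \<theta>_def by (simp only: powr_powr mult.commute)
      finally have "(2 ^ j :: real) powr (?d - M) = \<theta> ^ j" unfolding pw[OF \<theta>(1)] .
      then have 2: "R j powr (?d - M) = \<rho> powr (?d - M) * \<theta> ^ j"
        using \<rho> by (simp only: R_def powr_mult mult.commute)
      have "R j powr - M * (V * R (Suc j) ^ ?d) = V * 2 ^ ?d * (R j powr - M * R j ^ ?d)"
        by (simp add: R_def power_mult_distrib)
      also have "\<dots> = V * 2 ^ ?d * \<rho> powr (?d - M) * \<theta> ^ j"
        unfolding 1 2 by (simp only: mult.assoc)
      finally have 3: "R j powr - M * (V * R (Suc j) ^ ?d) = V * 2 ^ ?d * \<rho> powr (?d - M) * \<theta> ^ j" .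
      have 4: "emeasure lborel (cball a (R (Suc j))) = ennreal (V * R (Suc j) ^ ?d)"
        using R[of "Suc j"] by (simp add: emeasure_cball V_def)
      show ?thesis
        unfolding 4 3[symmetric] by (rule ennreal_mult'[symmetric]) simp
    qed
    have 4: "(\<Sum>j. ennreal (V * 2 ^ ?d * \<rho> powr (?d - M) * \<theta> ^ j)) =
        ennreal (V * 2 ^ ?d * \<rho> powr (?d - M) * (1 / (1 - \<theta>)))"
    proof (rule suminf_ennreal_eq)
      show "(\<lambda>j. V * 2 ^ ?d * \<rho> powr (?d - M) * \<theta> ^ j) sums
          (V * 2 ^ ?d * \<rho> powr (?d - M) * (1 / (1 - \<theta>)))"
        by (rule sums_mult[OF geometric_sums]) (use \<theta> in simp)
      show "0 \<le> V * 2 ^ ?d * \<rho> powr (?d - M) * \<theta> ^ j" for j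
        using \<theta> V by simp
    qed
    have 5: "C * \<rho> powr (?d - M) = V * 2 ^ ?d * \<rho> powr (?d - M) * (1 / (1 - \<theta>))"
      by (simp add: C_def)
    show "(\<integral>\<^sup>+u\<in>- ball a \<rho>. ennreal (norm (u - a) powr - M) \<partial>lborel) \<le>
        ennreal (C * \<rho> powr (?d - M))"
      using 1 unfolding 2 3 4 5 .
  qed
qed

section \<open>Harmonic functions with fast decay\<close>

text \<open>The partial derivatives in the definition are total functions given by
  \<open>deriv\<close>, so they agree with the explicit \<open>D\<close> only on \<open>S\<close>.
  As \<open>S\<close> is open, they agree near each of its points, which is enough to differentiate
  once more.\<close>

lemma harmonic_onI:
  fixes f :: "'a::euclidean_space \<Rightarrow> real"
  assumes "open S"
    and D1: "\<And>z b. z \<in> S \<Longrightarrow> b \<in> Basis \<Longrightarrow> ((\<lambda>h. f (z + h *\<^sub>R b)) has_real_derivative D b z) (at 0)"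
    and D2: "\<And>z b c. z \<in> S \<Longrightarrow> b \<in> Basis \<Longrightarrow> c \<in> Basis \<Longrightarrow>
      ((\<lambda>h. D b (z + h *\<^sub>R c)) has_real_derivative E b c z) (at 0)"
    and cont: "continuous_on S f" "\<And>b. b \<in> Basis \<Longrightarrow> continuous_on S (D b)"
      "\<And>b c. b \<in> Basis \<Longrightarrow> c \<in> Basis \<Longrightarrow> continuous_on S (E b c)"
    and laplace: "\<And>z. z \<in> S \<Longrightarrow> (\<Sum>b\<in>Basis. E b b z) = 0"
  shows "harmonic_on S f"
proof -
  have p1: "has_partial b f z \<and> partial b f z = D b z" if "z \<in> S" "b \<in> Basis" for b z
    using D1[OF that] by (auto simp: has_partial_def partial_def field_differentiable_def intro: DERIV_imp_deriv)
  have p2: "has_partial c (partial b f) z \<and> partial c (partial b f) z = E b c z"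
    if z: "z \<in> S" and bc: "b \<in> Basis" "c \<in> Basis" for b c z
  proof -
    have "open ((\<lambda>h::real. z + h *\<^sub>R c) -` S)"
      using assms(1) by (intro open_vimage continuous_intros)
    from eventually_nhds_in_open[OF this, of 0]
    have "\<forall>\<^sub>F h in nhds (0::real). z + h *\<^sub>R c \<in> S" using z by simp
    then have "\<forall>\<^sub>F h in nhds (0::real). partial b f (z + h *\<^sub>R c) = D b (z + h *\<^sub>R c)"
      by eventually_elim (use p1 bc in auto)
    from DERIV_cong_ev[OF refl this refl] D2[OF z bc]
    have "((\<lambda>h. partial b f (z + h *\<^sub>R c)) has_real_derivative E b c z) (at 0)" by simp
    then show ?thesis
      by (auto simp: has_partial_def partial_def[of c] field_differentiable_def intro: DERIV_imp_deriv)
  qed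
  have c1: "continuous_on S (partial b f)" if "b \<in> Basis" for b
    using cont(2)[OF that] p1 that by (auto cong: continuous_on_cong)
  have c2: "continuous_on S (partial c (partial b f))" if "b \<in> Basis" "c \<in> Basis" for b c
    using cont(3)[OF that] p2 that by (auto cong: continuous_on_cong)
  show ?thesis
    unfolding harmonic_on_def C2_on_def C1_on_def laplacian_def
    using cont(1) c1 c2 p1 p2 laplace by auto
qed

definition plane_coord :: "'a::euclidean_space \<Rightarrow> 'a \<Rightarrow> 'a \<Rightarrow> complex" where
  "plane_coord e e' z = Complex (z \<bullet> e) (z \<bullet> e')"

text \<open>The Kelvin transform of the homogeneous harmonic polynomial \<open>Re ((z \<bullet> e + \<i> z \<bullet> e') ^ l)\<close>.\<close>

definition kelvin :: "'a::euclidean_space \<Rightarrow> 'a \<Rightarrow> nat \<Rightarrow> 'a \<Rightarrow> real" where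
  "kelvin e e' l z =
     (z \<bullet> z) powr (1 - real l - real DIM('a) / 2) * Re (plane_coord e e' z ^ l)"

lemma bounded_linear_plane_coord: "bounded_linear (plane_coord e e')"
  by (rule bounded_linear_intro[where K = "norm e + norm e'"])
    (auto simp: plane_coord_def complex_eq_iff inner_add_left algebra_simps
      intro!: order.trans[OF cmod_le] add_mono Cauchy_Schwarz_ineq2)

lemma plane_coord_expand: "(\<Sum>b\<in>Basis. of_real (z \<bullet> b) * plane_coord e e' b) = plane_coord e e' z"
proof -
  interpret bounded_linear "plane_coord e e'" by (rule bounded_linear_plane_coord)
  have "plane_coord e e' z = plane_coord e e' (\<Sum>b\<in>Basis. (z \<bullet> b) *\<^sub>R b)"
    by (simp add: euclidean_representation)
  then show ?thesis by (simp add: sum scaleR scaleR_conv_of_real)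
qed

text \<open>Just 1 + i^2 = 0: the coefficient vector of this complex linear form is isotropic. This
  is why every power of \<open>plane_coord\<close> is harmonic.\<close>

lemma sum_plane_coord_square:
  fixes e e' :: "'a::euclidean_space"
  assumes "e \<in> Basis" "e' \<in> Basis" "e \<noteq> e'"
  shows "(\<Sum>b\<in>Basis. (plane_coord e e' b)\<^sup>2) = 0"
proof -
  have "(\<Sum>b\<in>Basis. (plane_coord e e' b)\<^sup>2) = (\<Sum>b\<in>Basis. (if b = e then 1 else 0) - (if b = e' then 1 else 0))"
    using assms by (intro sum.cong) (auto simp: plane_coord_def inner_Basis complex_eq_iff power2_eq_square)
  then show ?thesis using assms by (simp add: sum_subtractf)
qed

lemma has_real_derivative_inner_self_powr:
  fixes z b :: "'a::euclidean_space"
  assumes "z \<noteq> 0"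
  shows "((\<lambda>h. ((z + h *\<^sub>R b) \<bullet> (z + h *\<^sub>R b)) powr s) has_real_derivative
    2 * s * (z \<bullet> b) * (z \<bullet> z) powr (s - 1)) (at 0)"
proof -
  have 1: "((\<lambda>h. (z + h *\<^sub>R b) \<bullet> (z + h *\<^sub>R b)) has_real_derivative 2 * (z \<bullet> b)) (at 0)"
    by (auto intro!: derivative_eq_intros simp: inner_add_left inner_add_right inner_commute algebra_simps)
  have "((\<lambda>u. u powr s) has_real_derivative s * (z \<bullet> z) powr (s - 1)) (at ((z + 0 *\<^sub>R b) \<bullet> (z + 0 *\<^sub>R b)))"
    using has_real_derivative_powr[of "z \<bullet> z" s] assms by simp
  from DERIV_chain2[OF this 1] show ?thesis by (simp add: mult.commute mult.left_commute)
qed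

lemma has_real_derivative_Re_plane_coord_power:
  "((\<lambda>h. Re (w * plane_coord e e' (z + h *\<^sub>R b) ^ l)) has_real_derivative
    Re (w * of_nat l * plane_coord e e' z ^ (l - 1) * plane_coord e e' b)) (at 0)"
proof -
  interpret L: bounded_linear "plane_coord e e'" by (rule bounded_linear_plane_coord)
  have "((\<lambda>x. w * (plane_coord e e' z + x * plane_coord e e' b) ^ l) has_field_derivative
      w * of_nat l * plane_coord e e' z ^ (l - 1) * plane_coord e e' b) (at (of_real 0))"
    by (auto intro!: derivative_eq_intros)
  from has_vector_derivative_real_field[OF this]
  have "((\<lambda>h. w * (plane_coord e e' z + of_real h * plane_coord e e' b) ^ l) has_vector_derivative
      w * of_nat l * plane_coord e e' z ^ (l - 1) * plane_coord e e' b) (at 0)" .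
  from bounded_linear.has_vector_derivative[OF bounded_linear_Re this]
  show ?thesis
    unfolding has_real_derivative_iff_has_vector_derivative
    by (simp add: L.add L.scaleR scaleR_conv_of_real)
qed

lemma harmonic_on_kelvin:
  fixes e e' a :: "'a::euclidean_space"
  assumes "open S" "a \<notin> S" and e: "e \<in> Basis" "e' \<in> Basis" "e \<noteq> e'"
  shows "harmonic_on S (\<lambda>z. kelvin e e' l (z - a))"
proof -
  \<comment> \<open>\<open>z \<bullet> z\<close> is the squared norm, so \<open>s\<close> is half of
    the Kelvin exponent 2 - d - 2l. The Laplacian of the product turns out to be a multiple of
    \<open>real DIM('a) + 2 * (s - 1) + 2 * real l\<close>, which this choice makes 0.\<close>
  define s where "s = 1 - real l - real DIM('a) / 2"
  define w where "w z = plane_coord e e' z" for z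
  define P where "P z = Re (1 * w z ^ l)" for z
  \<comment> \<open>Truncated subtraction in the exponents is harmless, here and in
    \<open>P2\<close>: where it would matter, the factor \<open>of_nat l\<close> or
    \<open>of_nat (l - 1)\<close> is 0.\<close>
  define P1 where "P1 b z = Re (of_nat l * w b * w z ^ (l - 1))" for b z
  define P2 where "P2 b c z = Re (of_nat l * w b * of_nat (l - 1) * w z ^ (l - 1 - 1) * w c)" for b c z
  define R where "R t z = (z \<bullet> z) powr t" for t and z :: 'a
  define D1 where "D1 b z = 2 * s * (z \<bullet> b) * R (s - 1) z * P z + R s z * P1 b z" for b z
  define D2 where "D2 b c z =
      2 * s * (c \<bullet> b) * R (s - 1) z * P z
      + 2 * s * (z \<bullet> b) * (2 * (s - 1) * (z \<bullet> c) * R (s - 1 - 1) z) * P z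
      + 2 * s * (z \<bullet> b) * R (s - 1) z * P1 c z
      + (2 * s * (z \<bullet> c) * R (s - 1) z * P1 b z + R s z * P2 b c z)" for b c z
  have dR: "((\<lambda>h. R t (z + h *\<^sub>R b)) has_real_derivative 2 * t * (z \<bullet> b) * R (t - 1) z) (at 0)"
    if "z \<noteq> 0" for t z b
    unfolding R_def using that by (rule has_real_derivative_inner_self_powr)
  have dP: "((\<lambda>h. P (z + h *\<^sub>R b)) has_real_derivative P1 b z) (at 0)" for z b
    unfolding P_def P1_def w_def
    by (rule DERIV_cong[OF has_real_derivative_Re_plane_coord_power])
      (simp only: mult_1 mult.assoc mult.commute mult.left_commute)
  have dP1: "((\<lambda>h. P1 b (z + h *\<^sub>R c)) has_real_derivative P2 b c z) (at 0)" for z b c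
    unfolding P1_def P2_def w_def by (rule has_real_derivative_Re_plane_coord_power)
  have dI: "((\<lambda>h. 2 * s * ((z + h *\<^sub>R c) \<bullet> b)) has_real_derivative 2 * s * (c \<bullet> b)) (at 0)" for z b c :: 'a
    by (auto intro!: derivative_eq_intros simp: inner_add_left)
  have kel: "kelvin e e' l z = R s z * P z" for z
    by (simp add: kelvin_def R_def P_def s_def w_def)
  have d1: "((\<lambda>h. kelvin e e' l (z + h *\<^sub>R b)) has_real_derivative D1 b z) (at 0)" if "z \<noteq> 0" for z b
    unfolding kel using DERIV_mult[OF dR[OF that, of s b] dP[of z b]]
    by (simp add: D1_def mult.commute add.commute)
  have d2: "((\<lambda>h. D1 b (z + h *\<^sub>R c)) has_real_derivative D2 b c z) (at 0)" if "z \<noteq> 0" for z b c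
    unfolding D1_def
    by (rule DERIV_cong[OF DERIV_add[OF DERIV_mult[OF DERIV_mult[OF dI dR[OF that]] dP]
      DERIV_mult[OF dR[OF that] dP1]]]) (simp add: D2_def algebra_simps)
  have shift: "z + h *\<^sub>R b - a = (z - a) + h *\<^sub>R b" for z b h by simp
  have ne: "z - a \<noteq> 0" if "z \<in> S" for z using that assms(2) by auto
  have cw: "continuous_on S (\<lambda>z. w (z - a))"
    unfolding w_def by (intro bounded_linear.continuous_on[OF bounded_linear_plane_coord] continuous_intros)
  have cR: "continuous_on S (\<lambda>z. R t (z - a))" for t
    unfolding R_def using ne by (intro continuous_intros) auto
  have cP: "continuous_on S (\<lambda>z. P (z - a))" "continuous_on S (\<lambda>z. P1 b (z - a))"
    "continuous_on S (\<lambda>z. P2 b c (z - a))" for b c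
    unfolding P_def P1_def P2_def by (intro continuous_intros cw)+
  show ?thesis
  proof (rule harmonic_onI[OF assms(1), where D = "\<lambda>b z. D1 b (z - a)" and E = "\<lambda>b c z. D2 b c (z - a)"])
    show "continuous_on S (\<lambda>z. kelvin e e' l (z - a))"
      unfolding kel by (intro continuous_intros cR cP)
    show "continuous_on S (\<lambda>z. D1 b (z - a))" for b
      unfolding D1_def by (intro continuous_intros cR cP)
    show "continuous_on S (\<lambda>z. D2 b c (z - a))" for b c
      unfolding D2_def by (intro continuous_intros cR cP)
    fix z assume "z \<in> S"
    note z = ne[OF this]
    show "((\<lambda>h. kelvin e e' l (z + h *\<^sub>R b - a)) has_real_derivative D1 b (z - a)) (at 0)" for b
      unfolding shift by (rule d1[OF z])
    show "((\<lambda>h. D1 b (z + h *\<^sub>R c - a)) has_real_derivative D2 b c (z - a)) (at 0)" for b c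
      unfolding shift by (rule d2[OF z])
    define y where "y = z - a"
    have y: "y \<noteq> 0" using z by (simp add: y_def)
    have RR: "(y \<bullet> y) * R (s - 1 - 1) y = R (s - 1) y"
      using y powr_add[of "y \<bullet> y" 1 "s - 1 - 1"] by (simp add: R_def)
    have s1: "(\<Sum>b\<in>(Basis :: 'a set). b \<bullet> b) = real DIM('a)" by simp
    have s2: "(\<Sum>b\<in>Basis. (y \<bullet> b) * (y \<bullet> b)) = y \<bullet> y"
      using euclidean_inner[of y y] by simp
    \<comment> \<open>Euler's relation for the homogeneous polynomial \<open>P\<close> of degree
      \<open>l\<close>; it evaluates the cross terms of the product rule.\<close>
    have s3: "(\<Sum>b\<in>Basis. (y \<bullet> b) * P1 b y) = real l * P y"
    proof -
      have "(\<Sum>b\<in>Basis. (y \<bullet> b) * P1 b y) =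
          Re (of_nat l * w y ^ (l - 1) * (\<Sum>b\<in>Basis. of_real (y \<bullet> b) * w b))"
        by (simp add: P1_def sum_distrib_left Re_sum algebra_simps)
      also have "\<dots> = Re (of_nat l * w y ^ l)"
        unfolding w_def plane_coord_expand by (cases l) (auto simp: mult.commute mult.left_commute)
      finally show ?thesis by (simp add: P_def)
    qed
    have s4: "(\<Sum>b\<in>Basis. P2 b b y) = 0"
    proof -
      have "(\<Sum>b\<in>Basis. P2 b b y) =
          Re (of_nat l * of_nat (l - 1) * w y ^ (l - 1 - 1) * (\<Sum>b\<in>Basis. (w b)\<^sup>2))"
        unfolding sum_distrib_left Re_sum
        by (intro sum.cong refl)
          (simp only: P2_def power2_eq_square mult.assoc mult.commute mult.left_commute)
      then show ?thesis unfolding w_def sum_plane_coord_square[OF e] by simp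
    qed
    have "(\<Sum>b\<in>Basis. D2 b b y) =
        2 * s * R (s - 1) y * P y * (\<Sum>b\<in>(Basis :: 'a set). b \<bullet> b)
        + 4 * s * (s - 1) * P y * R (s - 1 - 1) y * (\<Sum>b\<in>Basis. (y \<bullet> b) * (y \<bullet> b))
        + 4 * s * R (s - 1) y * (\<Sum>b\<in>Basis. (y \<bullet> b) * P1 b y)
        + R s y * (\<Sum>b\<in>Basis. P2 b b y)"
      unfolding sum_distrib_left sum.distrib[symmetric]
      by (intro sum.cong) (auto simp: D2_def algebra_simps)
    also have "\<dots> = 2 * s * P y * R (s - 1) y * (real DIM('a) + 2 * (s - 1) + 2 * real l)"
      unfolding s1 s2 s3 s4 RR[symmetric] by (simp add: algebra_simps)
    also have "\<dots> = 0" by (simp add: s_def)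
    finally show "(\<Sum>b\<in>Basis. D2 b b (z - a)) = 0" by (simp add: y_def)
  qed
qed

lemma norm_plane_coord_le:
  fixes e e' :: "'a::euclidean_space"
  assumes "e \<in> Basis" "e' \<in> Basis" "e \<noteq> e'"
  shows "cmod (plane_coord e e' z) \<le> norm z"
proof -
  have "(\<Sum>b\<in>{e, e'}. (z \<bullet> b)\<^sup>2) \<le> (\<Sum>b\<in>Basis. (z \<bullet> b)\<^sup>2)"
    using assms by (intro sum_mono2) auto
  then show ?thesis
    using assms(3) by (simp add: plane_coord_def cmod_def norm_eq_sqrt_inner euclidean_inner[of z z] power2_eq_square)
qed

text \<open>In powers of the norm, the radial factor contributes 2 - 2l - d and the polynomial at
  most l. At the pole both sides are 0, since \<open>powr\<close> with base 0 is 0, so the bound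
  holds at every point.\<close>

lemma abs_kelvin_le:
  fixes e e' :: "'a::euclidean_space"
  assumes "e \<in> Basis" "e' \<in> Basis" "e \<noteq> e'"
  shows "\<bar>kelvin e e' l z\<bar> \<le> norm z powr - (real DIM('a) - 2 + real l)"
proof (cases "z = 0")
  case False
  have "\<bar>kelvin e e' l z\<bar> \<le> (z \<bullet> z) powr (1 - real l - real DIM('a) / 2) * norm z ^ l"
    unfolding kelvin_def abs_mult
    using abs_Re_le_cmod[of "plane_coord e e' z ^ l"] power_mono[OF norm_plane_coord_le[OF assms, of z], of l]
    by (auto simp: norm_power intro!: mult_left_mono)
  also have "z \<bullet> z = norm z powr 2" using False by (simp add: dot_square_norm)
  also have "norm z ^ l = norm z powr real l" using False by (simp add: powr_realpow)
  also have "(norm z powr 2) powr (1 - real l - real DIM('a) / 2) * norm z powr real l =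
      norm z powr - (real DIM('a) - 2 + real l)"
    unfolding powr_powr powr_add[symmetric] by (simp add: algebra_simps)
  finally show ?thesis .
qed (simp add: kelvin_def)

text \<open>Homogeneity carries a lower bound near one point of the unit sphere over to a cone, with
  the same power of the distance as in the upper bound.\<close>

lemma kelvin_scaleR:
  fixes e e' :: "'a::euclidean_space"
  assumes "0 < c"
  shows "kelvin e e' l (c *\<^sub>R z) = c powr - (real DIM('a) - 2 + real l) * kelvin e e' l z"
proof -
  interpret L: bounded_linear "plane_coord e e'" by (rule bounded_linear_plane_coord)
  define s where "s = 1 - real l - real DIM('a) / 2"
  have "(c *\<^sub>R z) \<bullet> (c *\<^sub>R z) = c powr 2 * (z \<bullet> z)" using assms by (simp add: power2_eq_square)
  then have 1: "((c *\<^sub>R z) \<bullet> (c *\<^sub>R z)) powr s = c powr (2 * s) * (z \<bullet> z) powr s"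
    by (simp only: powr_mult powr_powr)
  have 2: "Re (plane_coord e e' (c *\<^sub>R z) ^ l) = c powr real l * Re (plane_coord e e' z ^ l)"
    using assms by (simp add: L.scaleR scaleR_conv_of_real power_mult_distrib powr_realpow flip: of_real_power)
  have 3: "c powr (2 * s) * c powr real l = c powr - (real DIM('a) - 2 + real l)"
    unfolding powr_add[symmetric] by (simp add: s_def algebra_simps)
  show ?thesis
    unfolding kelvin_def s_def[symmetric] 1 2 3[symmetric] by simp
qed

text \<open>\<open>K\<close> is a Kelvin transform whose degree makes \<open>N\<close> as large as
  desired. It equals 1 at \<open>e\<close>, and continuity together with homogeneity gives the lower
  bound in a cone around the direction \<open>e\<close>. Dimension at least 2 provides the second
  axis on which \<open>plane_coord\<close> depends.\<close>

lemma harmonic_test_function_exists: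
  fixes e :: "'a::euclidean_space"
  assumes "e \<in> Basis" "2 \<le> DIM('a)"
  obtains N \<delta> and K :: "'a \<Rightarrow> real" where "N0 \<le> N" "0 < \<delta>"
    and "\<And>S a. open S \<Longrightarrow> a \<notin> S \<Longrightarrow> harmonic_on S (\<lambda>z. K (z - a))"
    and "\<And>z. \<bar>K z\<bar> \<le> norm z powr - N"
    and "\<And>c u. 0 < c \<Longrightarrow> norm (u - e) < \<delta> \<Longrightarrow> c powr - N / 2 \<le> K (c *\<^sub>R u)"
proof -
  have "\<exists>e'\<in>Basis. e' \<noteq> e"
  proof (rule ccontr)
    assume "\<not> ?thesis"
    then have "(Basis :: 'a set) \<subseteq> {e}" by auto
    from card_mono[OF _ this] assms(2) show False by simp
  qed
  then obtain e' where e': "e' \<in> Basis" "e \<noteq> e'" by auto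
  obtain l :: nat where l: "N0 \<le> real l" using real_arch_simple by blast
  define N where "N = real DIM('a) - 2 + real l"
  define K where "K = kelvin e e' l"
  have "N0 \<le> N" using l assms(2) by (simp add: N_def)
  have "K e = 1" using assms(1) e' by (simp add: K_def kelvin_def plane_coord_def inner_Basis flip: complex_of_real_def)
  have "isCont K e"
  proof -
    have "e \<noteq> 0" using assms(1) by auto
    then show ?thesis
      unfolding K_def kelvin_def
      by (intro continuous_intros isCont_Re isCont_power
          bounded_linear.isCont[OF bounded_linear_plane_coord]) auto
  qed
  then have "(K \<longlongrightarrow> K e) (nhds e)"
    by (simp add: isCont_def tendsto_at_iff_tendsto_nhds)
  then have "(K \<longlongrightarrow> 1) (nhds e)" by (simp only: \<open>K e = 1\<close>)
  then have "\<forall>\<^sub>F u in nhds e. 1 / 2 < K u" by (rule order_tendstoD(1)) simp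
  then obtain \<delta> where \<delta>: "0 < \<delta>" "\<And>u. dist u e < \<delta> \<Longrightarrow> 1 / 2 < K u"
    unfolding eventually_nhds_metric by blast
  show thesis
  proof (rule that[OF \<open>N0 \<le> N\<close> \<delta>(1)])
    show "harmonic_on S (\<lambda>z. K (z - a))" if "open S" "a \<notin> S" for S a
      unfolding K_def using that assms(1) e' by (rule harmonic_on_kelvin)
    show "\<bar>K z\<bar> \<le> norm z powr - N" for z
      unfolding K_def N_def using assms(1) e' by (rule abs_kelvin_le)
    show "c powr - N / 2 \<le> K (c *\<^sub>R u)" if "0 < c" "norm (u - e) < \<delta>" for c u
    proof -
      have "1 / 2 \<le> K u" using \<delta>(2)[of u] that(2) by (simp add: dist_norm)
      then have "c powr - N * (1 / 2) \<le> c powr - N * K u" by (intro mult_left_mono) auto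
      then show ?thesis unfolding K_def N_def kelvin_scaleR[OF that(1)] by simp
    qed
  qed
qed

section \<open>Whitney cubes\<close>

lemma mem_axis_cube:
  "z \<in> axis_cube c l \<longleftrightarrow> (\<forall>b\<in>Basis. \<bar>(z - c) \<bullet> b\<bar> \<le> l / 2)"
proof -
  have "((c - (l / 2) *\<^sub>R One) \<bullet> b \<le> z \<bullet> b \<and> z \<bullet> b \<le> (c + (l / 2) *\<^sub>R One) \<bullet> b) \<longleftrightarrow>
      \<bar>(z - c) \<bullet> b\<bar> \<le> l / 2" if "b \<in> Basis" for b
    unfolding inner_diff_left inner_add_left inner_scaleR_left inner_One[OF that] by arith
  then show ?thesis unfolding axis_cube_def mem_box by blast
qed

lemma snd_axis_in_Basis: "(0, 1) \<in> (Basis :: ('a::euclidean_space \<times> real) set)"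
  by (simp add: Basis_prod_def)

lemma snd_eq_inner: "snd (z :: 'a::euclidean_space \<times> real) = z \<bullet> (0, 1)"
  by (simp add: inner_prod_def)

lemma abs_snd_le_norm: "\<bar>snd (z :: 'a::euclidean_space \<times> real)\<bar> \<le> norm z"
  unfolding snd_eq_inner by (rule Basis_le_norm[OF snd_axis_in_Basis])

lemma norm_le_norm_One:
  fixes z :: "'a::euclidean_space"
  assumes "\<And>b. b \<in> Basis \<Longrightarrow> \<bar>z \<bullet> b\<bar> \<le> r" "0 \<le> r"
  shows "norm z \<le> r * norm (One :: 'a::euclidean_space)"
proof -
  have "norm z \<le> norm (r *\<^sub>R (One :: 'a))"
    using assms by (intro norm_le_componentwise) (simp add: inner_One)
  then show ?thesis using assms(2) by simp
qed

lemma whitney_decomposition_cube: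
  "whitney_decomposition \<Delta> \<zeta> \<Longrightarrow> \<exists>l>0. \<Delta> k = axis_cube (\<zeta> k) l"
  by (simp add: whitney_decomposition_def)

text \<open>Later arguments need no diameters or distances, only that the side of a cube and the
  height of its bottom face are at least a fixed fraction \<kappa> of the height of its centre. Both
  follow once the distance to the boundary is identified with the height \<open>h k\<close> of the
  bottom face, and the diameter with \<open>l k * \<nu>\<close>.\<close>

lemma whitney_decomposition_scale:
  fixes \<Delta> :: "nat \<Rightarrow> ((real ^ 'n) \<times> real) set"
  assumes "whitney_decomposition \<Delta> \<zeta>"
  obtains \<kappa> l where "0 < \<kappa>"
    and "\<And>k. \<Delta> k = axis_cube (\<zeta> k) (l k)" and "\<And>k. 0 < l k" and "\<And>k. 0 < snd (\<zeta> k)"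
    and "\<And>k. \<kappa> * snd (\<zeta> k) \<le> l k" and "\<And>k. \<kappa> * snd (\<zeta> k) \<le> snd (\<zeta> k) - l k / 2"
proof -
  let ?e = "(0, 1) :: (real ^ 'n) \<times> real"
  define \<nu> where "\<nu> = norm (One :: (real ^ 'n) \<times> real)"
  have \<nu>: "0 < \<nu>" unfolding \<nu>_def by simp
  have "\<forall>k. \<exists>l. 0 < l \<and> \<Delta> k = axis_cube (\<zeta> k) l"
    using whitney_decomposition_cube[OF assms] by simp
  from choice[OF this] obtain l where "\<forall>k. 0 < l k \<and> \<Delta> k = axis_cube (\<zeta> k) (l k)" ..
  then have l: "\<And>k. 0 < l k" "\<And>k. \<Delta> k = axis_cube (\<zeta> k) (l k)" by auto
  have "\<exists>a>0. \<exists>b>0. \<forall>k. a * setdist (\<Delta> k) (frontier half_space) \<le> diameter (\<Delta> k) \<and>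
      diameter (\<Delta> k) \<le> b * setdist (\<Delta> k) (frontier half_space)"
    using assms unfolding whitney_decomposition_def by (elim conjE)
  then obtain a b where ab: "0 < a" "0 < b"
    "\<And>k. a * setdist (\<Delta> k) (frontier half_space) \<le> diameter (\<Delta> k)"
    "\<And>k. diameter (\<Delta> k) \<le> b * setdist (\<Delta> k) (frontier half_space)"
    by (elim exE conjE) simp
  have union: "(\<Union>k. \<Delta> k) = half_space" using assms by (simp add: whitney_decomposition_def)
  have "half_space = {x. ?e \<bullet> x > (0::real)}"
    by (auto simp: half_space_def inner_prod_def)
  then have fr: "frontier half_space = {z :: (real ^ 'n) \<times> real. snd z = 0}"
    using frontier_halfspace_gt[of ?e 0] by (simp add: inner_prod_def zero_prod_def)
  define h where "h k = snd (\<zeta> k) - l k / 2" for k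
  have h: "0 < h k" "setdist (\<Delta> k) (frontier half_space) = h k" for k
  proof -
    \<comment> \<open>A corner of the bottom face; its vertical projection to the boundary realises
      the distance.\<close>
    define p where "p = \<zeta> k - (l k / 2) *\<^sub>R One"
    have p: "p \<in> \<Delta> k" using l(1)[of k] by (simp add: l(2) p_def axis_cube_def mem_box inner_diff_left inner_add_left inner_One)
    have sp: "snd p = h k"
      unfolding snd_eq_inner p_def h_def by (simp only: inner_diff_left inner_scaleR_left inner_One[OF snd_axis_in_Basis])
    have "p \<in> half_space" using p union by blast
    then show "0 < h k" using sp by (simp add: half_space_def)
    show "setdist (\<Delta> k) (frontier half_space) = h k"
    proof (rule antisym)
      have "setdist (\<Delta> k) (frontier half_space) \<le> dist p (p - h k *\<^sub>R ?e)"
        using p sp by (intro setdist_le_dist) (auto simp: fr)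
      then show "setdist (\<Delta> k) (frontier half_space) \<le> h k"
        using \<open>0 < h k\<close> by (simp add: dist_norm norm_Pair)
      show "h k \<le> setdist (\<Delta> k) (frontier half_space)"
      proof (rule le_setdistI)
        show "\<Delta> k \<noteq> {}" using p by auto
        have "(0, 0) \<in> frontier (half_space :: ((real ^ 'n) \<times> real) set)" by (simp add: fr)
        then show "frontier (half_space :: ((real ^ 'n) \<times> real) set) \<noteq> {}" by blast
        fix x y :: "(real ^ 'n) \<times> real" assume x: "x \<in> \<Delta> k" and y: "y \<in> frontier half_space"
        have "\<bar>snd x - snd (\<zeta> k)\<bar> \<le> l k / 2"
          using x snd_axis_in_Basis unfolding l(2) mem_axis_cube snd_eq_inner inner_diff_left[symmetric] by blast
        then have "snd (\<zeta> k) - l k / 2 \<le> snd x" by arith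
        then have "h k \<le> snd (x - y)" using y by (simp add: fr h_def)
        also have "\<dots> \<le> dist x y" using abs_snd_le_norm[of "x - y"] by (simp add: dist_norm)
        finally show "h k \<le> dist x y" .
      qed
    qed
  qed
  have diam: "diameter (\<Delta> k) = l k * \<nu>" for k
  proof -
    have "diameter (\<Delta> k) = dist (\<zeta> k - (l k / 2) *\<^sub>R One) (\<zeta> k + (l k / 2) *\<^sub>R One)"
      unfolding l(2) axis_cube_def using l(1)[of k]
      by (intro diameter_cbox) (simp add: inner_diff_left inner_add_left inner_One)
    also have "\<dots> = norm (l k *\<^sub>R (One :: (real ^ 'n) \<times> real))"
      unfolding dist_norm by (subst norm_minus_commute) (simp add: algebra_simps flip: scaleR_add_left)
    finally show ?thesis using l(1)[of k] by (simp add: \<nu>_def)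
  qed
  \<comment> \<open>The centre has height \<open>h k + l k / 2\<close>, and \<open>l k\<close> is at
    most \<open>b * h k / \<nu>\<close>; so it is at most \<open>B\<close> times as high as the
    bottom face.\<close>
  define B where "B = 1 + b / (2 * \<nu>)"
  have B: "0 < B" using ab \<nu> by (auto simp: B_def add_pos_pos)
  have hB: "snd (\<zeta> k) \<le> B * h k" for k
  proof -
    have "l k \<le> b * h k / \<nu>" using ab(4)[of k] \<nu> by (simp add: diam h(2) field_simps)
    then have "l k / 2 \<le> b * h k / \<nu> / 2" by (rule divide_right_mono) simp
    moreover have "B * h k = h k + b * h k / \<nu> / 2" by (simp add: B_def ring_distribs)
    moreover have "snd (\<zeta> k) = h k + l k / 2" by (simp add: h_def)
    ultimately show ?thesis by (simp only: add_left_mono)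
  qed
  have la: "a / \<nu> * h k \<le> l k" for k
    using ab(3)[of k] \<nu> by (simp add: diam h(2) field_simps)
  define \<kappa> where "\<kappa> = min (1 / B) (a / (\<nu> * B))"
  have "0 < \<kappa>" using ab \<nu> B by (simp add: \<kappa>_def)
  have \<eta>: "0 < snd (\<zeta> k)" for k using h(1)[of k] l(1)[of k] by (simp add: h_def)
  show thesis
  proof (rule that[OF \<open>0 < \<kappa>\<close> l(2,1) \<eta>])
    fix k
    have hB': "snd (\<zeta> k) / B \<le> h k" using hB[of k] B by (simp add: pos_divide_le_eq mult.commute)
    have "\<kappa> * snd (\<zeta> k) \<le> 1 / B * snd (\<zeta> k)"
      using \<eta>[of k] by (intro mult_right_mono) (auto simp: \<kappa>_def)
    then show "\<kappa> * snd (\<zeta> k) \<le> snd (\<zeta> k) - l k / 2" using hB' by (simp add: h_def)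
    have "\<kappa> * snd (\<zeta> k) \<le> a / (\<nu> * B) * snd (\<zeta> k)"
      using \<eta>[of k] by (intro mult_right_mono) (auto simp: \<kappa>_def)
    also have "\<dots> = a / \<nu> * (snd (\<zeta> k) / B)" by simp
    also have "\<dots> \<le> a / \<nu> * h k" using hB' ab \<nu> by (intro mult_left_mono) auto
    also note la
    finally show "\<kappa> * snd (\<zeta> k) \<le> l k" .
  qed
qed

section \<open>Comparison of powers, small cubes and sums of products\<close>

lemma ennreal_powr_ennreal: "0 \<le> x \<Longrightarrow> ennreal_powr (ennreal x) r = ennreal (x powr r)"
  by (simp add: ennreal_powr_def)

lemma ennreal_powr_mono:
  assumes "x \<le> y" "0 \<le> r"
  shows "ennreal_powr x r \<le> ennreal_powr y r"
proof (cases "y = top")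
  case False
  then have "x \<noteq> top" using assms(1) by (auto simp: top_unique)
  have "enn2real x \<le> enn2real y" using assms(1) False by (intro enn2real_mono) (auto simp: less_top)
  then show ?thesis
    using False \<open>x \<noteq> top\<close> assms(2) by (auto simp: ennreal_powr_def intro!: ennreal_leI powr_mono2)
qed (simp add: ennreal_powr_def)

text \<open>The weight exponent may have either sign, and the sign decides which endpoint is
  extremal. The minimum here, and the maximum in \<open>powr_le_max\<close>, cover both cases with
  one constant.\<close>

lemma powr_ge_min:
  fixes t :: real
  assumes "0 < a" "a \<le> t" "t \<le> b"
  shows "min (a powr r) (b powr r) \<le> t powr r"
proof (cases "0 \<le> r")
  case True
  then have "a powr r \<le> t powr r" using assms by (intro powr_mono2) auto
  then show ?thesis by simp
next
  case False
  then have "b powr r \<le> t powr r" using assms by (intro powr_mono2') auto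
  then show ?thesis by simp
qed

lemma powr_le_max:
  fixes t :: real
  assumes "0 < a" "a \<le> t" "t \<le> b"
  shows "t powr r \<le> max (a powr r) (b powr r)"
proof (cases "0 \<le> r")
  case True
  then have "t powr r \<le> b powr r" using assms by (intro powr_mono2) auto
  then show ?thesis by simp
next
  case False
  then have "t powr r \<le> a powr r" using assms by (intro powr_mono2') auto
  then show ?thesis by simp
qed

lemma emeasure_box_One:
  "0 \<le> l \<Longrightarrow> emeasure lborel (box (c - (l / 2) *\<^sub>R One) (c + (l / 2) *\<^sub>R One) :: 'a::euclidean_space set) =
     ennreal (l ^ DIM('a))"
  by (subst emeasure_lborel_box) (auto simp: inner_diff_left inner_add_left inner_One)

lemma emeasure_axis_cube:
  "0 \<le> l \<Longrightarrow> emeasure lborel (axis_cube c l :: 'a::euclidean_space set) = ennreal (l ^ DIM('a))"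
  unfolding axis_cube_def by (subst emeasure_lborel_cbox) (auto simp: inner_diff_left inner_add_left inner_One)

text \<open>A ball around \<open>z\<close> need not lie in the cube, as \<open>z\<close> may be a
  boundary point. Contracting the cube towards \<open>z\<close> by the factor
  \<open>\<epsilon> / l\<close> keeps it inside, by convexity, and leaves a cube of side \<epsilon>
  next to \<open>z\<close>.\<close>

lemma axis_cube_contract:
  fixes \<zeta> z :: "'a::euclidean_space"
  assumes "z \<in> axis_cube \<zeta> l" "0 < \<epsilon>" "\<epsilon> \<le> l"
  obtains c where "box (c - (\<epsilon> / 2) *\<^sub>R One) (c + (\<epsilon> / 2) *\<^sub>R One) \<subseteq> interior (axis_cube \<zeta> l)"
    and "\<And>w b. w \<in> box (c - (\<epsilon> / 2) *\<^sub>R One) (c + (\<epsilon> / 2) *\<^sub>R One) \<Longrightarrow> b \<in> Basis \<Longrightarrow> \<bar>(w - z) \<bullet> b\<bar> \<le> \<epsilon>"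
proof -
  define \<theta> where "\<theta> = \<epsilon> / l"
  have \<theta>: "0 < \<theta>" "\<theta> \<le> 1" "\<theta> * l = \<epsilon>" using assms by (auto simp: \<theta>_def)
  define c where "c = z + \<theta> *\<^sub>R (\<zeta> - z)"
  have cb: "\<bar>(w - \<zeta>) \<bullet> b\<bar> < l / 2 \<and> \<bar>(w - z) \<bullet> b\<bar> \<le> \<epsilon>"
    if w: "w \<in> box (c - (\<epsilon> / 2) *\<^sub>R One) (c + (\<epsilon> / 2) *\<^sub>R One)" and b: "b \<in> Basis" for w b
  proof -
    have "(c - (\<epsilon> / 2) *\<^sub>R One) \<bullet> b < w \<bullet> b \<and> w \<bullet> b < (c + (\<epsilon> / 2) *\<^sub>R One) \<bullet> b"
      using w b by (simp add: mem_box)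
    then have 1: "\<bar>(w - c) \<bullet> b\<bar> < \<epsilon> / 2"
      unfolding inner_diff_left inner_add_left inner_scaleR_left inner_One[OF b] by arith
    have 2: "\<bar>(z - \<zeta>) \<bullet> b\<bar> \<le> l / 2" using assms(1) b by (simp add: mem_axis_cube)
    have "(w - \<zeta>) \<bullet> b = (w - c) \<bullet> b + (1 - \<theta>) * ((z - \<zeta>) \<bullet> b)"
      by (simp add: c_def inner_diff_left inner_add_left algebra_simps)
    moreover have "\<bar>(1 - \<theta>) * ((z - \<zeta>) \<bullet> b)\<bar> \<le> (1 - \<theta>) * (l / 2)"
      unfolding abs_mult using \<theta> 2 by (intro mult_mono) auto
    moreover have "(1 - \<theta>) * (l / 2) = l / 2 - \<epsilon> / 2" unfolding \<theta>(3)[symmetric] by (simp add: field_simps)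
    ultimately have A: "\<bar>(w - \<zeta>) \<bullet> b\<bar> < l / 2" using 1 by linarith
    have "(w - z) \<bullet> b = (w - c) \<bullet> b - \<theta> * ((z - \<zeta>) \<bullet> b)"
      by (simp add: c_def inner_diff_left inner_add_left algebra_simps)
    moreover have "\<bar>\<theta> * ((z - \<zeta>) \<bullet> b)\<bar> \<le> \<theta> * (l / 2)"
      unfolding abs_mult using \<theta> 2 by (intro mult_mono) auto
    moreover have "\<theta> * (l / 2) = \<epsilon> / 2" by (simp flip: \<theta>(3))
    ultimately have "\<bar>(w - z) \<bullet> b\<bar> \<le> \<epsilon>" using 1 by linarith
    with A show ?thesis by simp
  qed
  show thesis
  proof (rule that[of c])
    show "box (c - (\<epsilon> / 2) *\<^sub>R One) (c + (\<epsilon> / 2) *\<^sub>R One) \<subseteq> interior (axis_cube \<zeta> l)"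
    proof (rule interior_maximal)
      show "box (c - (\<epsilon> / 2) *\<^sub>R One) (c + (\<epsilon> / 2) *\<^sub>R One) \<subseteq> axis_cube \<zeta> l"
        using cb by (force simp: mem_axis_cube intro: less_imp_le)
    qed (rule open_box)
  qed (use cb in blast)
qed

lemma prod_mono_ennreal:
  fixes f g :: "'i \<Rightarrow> ennreal"
  shows "(\<And>i. i \<in> A \<Longrightarrow> f i \<le> g i) \<Longrightarrow> prod f A \<le> prod g A"
  by (induction A rule: infinite_finite_induct) (auto intro!: mult_mono)

text \<open>Expanding the product of the sums yields all diagonal products among other nonnegative
  terms. For empty \<open>I\<close> the left side would be a divergent series of ones; this is where
  m \<ge> 1 enters.\<close>

lemma suminf_prod_le_prod_suminf:
  fixes a :: "'i \<Rightarrow> nat \<Rightarrow> ennreal"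
  assumes "finite I" "I \<noteq> {}"
  shows "(\<Sum>k. \<Prod>i\<in>I. a i k) \<le> (\<Prod>i\<in>I. \<Sum>k. a i k)"
  using assms
proof (induction I rule: finite_ne_induct)
  case (insert j F)
  have le: "(\<Prod>i\<in>F. a i k) \<le> (\<Sum>k. \<Prod>i\<in>F. a i k)" for k
    using sum_le_suminf[OF summableI, of "{k}" "\<lambda>k. \<Prod>i\<in>F. a i k"] by simp
  have "(\<Sum>k. \<Prod>i\<in>insert j F. a i k) = (\<Sum>k. a j k * (\<Prod>i\<in>F. a i k))"
    using insert.hyps by simp
  also have "\<dots> \<le> (\<Sum>k. a j k * (\<Sum>k. \<Prod>i\<in>F. a i k))"
    by (intro suminf_le mult_left_mono le summableI) auto
  also have "\<dots> = (\<Sum>k. a j k) * (\<Sum>k. \<Prod>i\<in>F. a i k)" by simp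
  also have "\<dots> \<le> (\<Sum>k. a j k) * (\<Prod>i\<in>F. \<Sum>k. a i k)"
    by (intro mult_left_mono insert.IH) auto
  finally show ?case using insert.hyps by simp
qed simp

lemma open_half_space: "open half_space"
  unfolding half_space_def by (intro open_Collect_less continuous_intros)

section \<open>Lower bounds for the cube integrals\<close>

text \<open>On the ball the height is comparable to \<eta>, so the weight can be replaced by a
  multiple of \<open>\<eta> powr \<alpha>\<close>; the sub-mean-value inequality supplies
  \<open>\<eta> powr d\<close>, and the power \<open>q / \<sigma>\<close> does the rest. The
  constant \<open>c\<close> depends neither on \<open>z\<close> nor on \<eta>, as summation over all
  cubes requires.\<close>

lemma ennreal_powr_weighted_integral_ge:
  fixes f :: "(real ^ 'n) \<times> real \<Rightarrow> real" and \<alpha> :: real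
  assumes \<sigma>: "0 < \<sigma>" and q: "0 < q" and \<kappa>: "0 < \<kappa>"
    and cont: "continuous_on half_space f"
    and C: "0 < C" and avg: "ennreal (\<bar>f z\<bar> powr \<sigma> * \<epsilon> ^ DIM((real ^ 'n) \<times> real)) \<le>
      ennreal C * (\<integral>\<^sup>+x\<in>cball z \<epsilon>. ennreal (\<bar>f x\<bar> powr \<sigma>) \<partial>lborel)"
    and \<eta>: "0 < \<eta>" and \<epsilon>: "\<epsilon> = \<kappa> * \<eta> / 8"
    and heights: "\<And>u. u \<in> cball z \<epsilon> \<Longrightarrow> \<kappa> / 2 * \<eta> \<le> snd u \<and> snd u \<le> 3 * \<eta>"
    and sub: "cball z \<epsilon> \<subseteq> Q"
  defines "d \<equiv> real DIM((real ^ 'n) \<times> real)"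
  defines "c \<equiv> min ((\<kappa> / 2) powr \<alpha>) (3 powr \<alpha>) * (\<kappa> / 8) powr d / C"
  shows "ennreal (c powr (q / \<sigma>) * (\<eta> powr ((d + \<alpha>) * q / \<sigma>) * \<bar>f z\<bar> powr q)) \<le>
    ennreal_powr (\<integral>\<^sup>+x\<in>Q. ennreal (\<bar>f x\<bar> powr \<sigma> * snd x powr \<alpha>) \<partial>lborel) (q / \<sigma>)"
proof -
  let ?d = "DIM((real ^ 'n) \<times> real)"
  have pw: "x ^ ?d = x powr d" if "0 < x" for x :: real
    unfolding d_def by (rule powr_realpow[OF that, symmetric])
  define m where "m = min ((\<kappa> / 2) powr \<alpha>) (3 powr \<alpha>)"
  have m: "0 < m" using \<kappa> by (simp add: m_def)
  have c: "0 < c" unfolding c_def m_def[symmetric] using m \<kappa> C by simp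
  have cb: "cball z \<epsilon> \<subseteq> half_space"
  proof
    fix u assume u: "u \<in> cball z \<epsilon>"
    have "0 < \<kappa> / 2 * \<eta>" using \<kappa> \<eta> by simp
    then show "u \<in> half_space"
      unfolding half_space_def mem_Collect_eq using heights[OF u] by linarith
  qed
  have meas: "(\<lambda>x. ennreal (\<bar>f x\<bar> powr \<sigma>) * indicator (cball z \<epsilon>) x) \<in> borel_measurable lborel"
    using cont cb \<sigma>
    by (auto intro!: borel_measurable_ennreal_indicator continuous_intros continuous_on_powr'
        intro: continuous_on_subset)
  define J where "J = (\<integral>\<^sup>+x\<in>cball z \<epsilon>. ennreal (\<bar>f x\<bar> powr \<sigma>) \<partial>lborel)"
  have "(\<epsilon>::real) ^ ?d = (\<kappa> / 8) powr d * \<eta> powr d"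
    using power_mult_distrib[of "\<kappa> / 8" \<eta> ?d] \<kappa> \<eta> pw[of "\<kappa> / 8"] pw[of \<eta>]
    by (simp only: \<epsilon> times_divide_eq_left)
  then have "c * (\<eta> powr (d + \<alpha>) * \<bar>f z\<bar> powr \<sigma>) = (m * \<eta> powr \<alpha> / C) * (\<bar>f z\<bar> powr \<sigma> * \<epsilon> ^ ?d)"
    by (simp add: c_def m_def powr_add)
  then have "ennreal (c * (\<eta> powr (d + \<alpha>) * \<bar>f z\<bar> powr \<sigma>)) =
      ennreal ((m * \<eta> powr \<alpha> / C) * (\<bar>f z\<bar> powr \<sigma> * \<epsilon> ^ ?d))"
    by (rule arg_cong)
  also have "\<dots> = ennreal (m * \<eta> powr \<alpha> / C) * ennreal (\<bar>f z\<bar> powr \<sigma> * \<epsilon> ^ ?d)"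
    by (rule ennreal_mult') (use m C in simp)
  also have "\<dots> \<le> ennreal (m * \<eta> powr \<alpha> / C) * (ennreal C * J)"
    unfolding J_def by (intro mult_left_mono avg) simp
  also have "\<dots> = ennreal (m * \<eta> powr \<alpha>) * J"
    using m C by (simp add: mult.assoc[symmetric] ennreal_mult'[symmetric])
  also have "\<dots> = (\<integral>\<^sup>+x. ennreal (m * \<eta> powr \<alpha>) * (ennreal (\<bar>f x\<bar> powr \<sigma>) * indicator (cball z \<epsilon>) x) \<partial>lborel)"
    unfolding J_def by (rule nn_integral_cmult[OF meas, symmetric])
  also have "\<dots> \<le> (\<integral>\<^sup>+x\<in>Q. ennreal (\<bar>f x\<bar> powr \<sigma> * snd x powr \<alpha>) \<partial>lborel)"
  proof (rule nn_integral_mono)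
    fix x
    show "ennreal (m * \<eta> powr \<alpha>) * (ennreal (\<bar>f x\<bar> powr \<sigma>) * indicator (cball z \<epsilon>) x) \<le>
        ennreal (\<bar>f x\<bar> powr \<sigma> * snd x powr \<alpha>) * indicator Q x"
    proof (cases "x \<in> cball z \<epsilon>")
      case True
      define t where "t = snd x / \<eta>"
      have "\<kappa> / 2 \<le> t" "t \<le> 3" using heights[OF True] \<eta> by (auto simp: t_def field_simps)
      then have "m \<le> t powr \<alpha>" unfolding m_def using \<kappa> by (intro powr_ge_min) auto
      then have "m * \<eta> powr \<alpha> \<le> t powr \<alpha> * \<eta> powr \<alpha>" by (intro mult_right_mono) auto
      also have "\<dots> = snd x powr \<alpha>" using \<eta> by (simp add: t_def flip: powr_mult)
      finally have "m * \<eta> powr \<alpha> * \<bar>f x\<bar> powr \<sigma> \<le> snd x powr \<alpha> * \<bar>f x\<bar> powr \<sigma>"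
        by (intro mult_right_mono) auto
      then show ?thesis
        using True sub m by (auto simp: ennreal_mult'[symmetric] mult.commute intro!: ennreal_leI)
    qed simp
  qed
  finally have "ennreal_powr (ennreal (c * (\<eta> powr (d + \<alpha>) * \<bar>f z\<bar> powr \<sigma>))) (q / \<sigma>) \<le>
      ennreal_powr (\<integral>\<^sup>+x\<in>Q. ennreal (\<bar>f x\<bar> powr \<sigma> * snd x powr \<alpha>) \<partial>lborel) (q / \<sigma>)"
    using \<sigma> q by (intro ennreal_powr_mono) auto
  also have "ennreal_powr (ennreal (c * (\<eta> powr (d + \<alpha>) * \<bar>f z\<bar> powr \<sigma>))) (q / \<sigma>) =
      ennreal (c powr (q / \<sigma>) * (\<eta> powr ((d + \<alpha>) * q / \<sigma>) * \<bar>f z\<bar> powr q))"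
    using c \<sigma> by (subst ennreal_powr_ennreal) (auto simp: powr_mult powr_powr)
  finally show ?thesis .
qed

text \<open>Contracting \<open>\<Delta> k\<close> towards \<open>z k\<close> gives a cube of side comparable to \<open>snd (\<zeta> k)\<close> inside the interior
  of \<open>\<Delta> k\<close> and close to \<open>z k\<close>. These cubes are pairwise disjoint, so the overlap of the dilated
  cubes plays no role.\<close>

lemma whitney_suminf_le_integral:
  fixes \<Delta> :: "nat \<Rightarrow> ((real ^ 'n) \<times> real) set" and \<alpha> :: real
  assumes W: "whitney_decomposition \<Delta> \<zeta>" and \<sigma>: "0 < \<sigma>" and q: "0 < q"
  defines "d \<equiv> real DIM((real ^ 'n) \<times> real)"
  shows "\<exists>C>0. \<forall>f z. harmonic_on half_space f \<longrightarrow> (\<forall>k. z k \<in> \<Delta> k) \<longrightarrow>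
    (\<Sum>k. ennreal (snd (\<zeta> k) powr (d + (d + \<alpha>) * q / \<sigma>) * \<bar>f (z k)\<bar> powr q)) \<le>
      ennreal C * (\<integral>\<^sup>+w\<in>half_space. ennreal_powr
        (\<integral>\<^sup>+x\<in>Q_cube w. ennreal (\<bar>f x\<bar> powr \<sigma> * snd x powr \<alpha>) \<partial>lborel) (q / \<sigma>) \<partial>lborel)"
proof -
  let ?d = "DIM((real ^ 'n) \<times> real)"
  have pw: "x ^ ?d = x powr d" if "0 < x" for x :: real
    unfolding d_def by (rule powr_realpow[OF that, symmetric])
  obtain \<kappa> l where \<kappa>: "0 < \<kappa>"
    and \<Delta>: "\<And>k. \<Delta> k = axis_cube (\<zeta> k) (l k)" and l: "\<And>k. 0 < l k" and \<eta>: "\<And>k. 0 < snd (\<zeta> k)"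
    and \<kappa>l: "\<And>k. \<kappa> * snd (\<zeta> k) \<le> l k" and \<kappa>h: "\<And>k. \<kappa> * snd (\<zeta> k) \<le> snd (\<zeta> k) - l k / 2"
    by (rule whitney_decomposition_scale[OF W]) (rule that)
  have disj: "interior (\<Delta> j) \<inter> interior (\<Delta> k) = {}" if "j \<noteq> k" for j k
    using W that by (simp add: whitney_decomposition_def)
  have union: "(\<Union>k. \<Delta> k) = half_space" using W by (simp add: whitney_decomposition_def)
  obtain C where C: "0 < C" and avg: "\<And>S (f :: (real ^ 'n) \<times> real \<Rightarrow> real) z r. open S \<Longrightarrow>
      harmonic_on S f \<Longrightarrow> 0 < r \<Longrightarrow> cball z r \<subseteq> S \<Longrightarrow>
      ennreal (\<bar>f z\<bar> powr \<sigma> * r ^ ?d) \<le> ennreal C * (\<integral>\<^sup>+x\<in>cball z r. ennreal (\<bar>f x\<bar> powr \<sigma>) \<partial>lborel)"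
    using harmonic_powr_le_average[OF \<sigma>, where 'a = "(real ^ 'n) \<times> real"] by meson
  define c where "c = (min ((\<kappa> / 2) powr \<alpha>) (3 powr \<alpha>) * (\<kappa> / 8) powr d / C) powr (q / \<sigma>)"
  have "0 < min ((\<kappa> / 2) powr \<alpha>) (3 powr \<alpha>)" using \<kappa> by simp
  then have "0 < min ((\<kappa> / 2) powr \<alpha>) (3 powr \<alpha>) * (\<kappa> / 8) powr d / C"
    using \<kappa> C by (intro divide_pos_pos mult_pos_pos) auto
  then have c: "0 < c" unfolding c_def powr_gt_zero by (rule less_imp_neq[THEN not_sym])
  \<comment> \<open>Small enough for two purposes. A point within \<open>\<epsilon> k\<close> of
    \<open>z k\<close> keeps a height comparable to that of the centre, and it differs from any
    \<open>w\<close> in the small cube by at most \<open>2 * \<epsilon> k\<close> in each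
    coordinate, hence lies in \<open>Q_cube w\<close>, whose side is at least
    \<open>\<kappa> * snd (\<zeta> k)\<close>.\<close>
  define \<epsilon> where "\<epsilon> k = \<kappa> * snd (\<zeta> k) / 8" for k
  have \<epsilon>: "0 < \<epsilon> k" "\<epsilon> k \<le> l k" for k
    using mult_pos_pos[OF \<kappa> \<eta>[of k]] \<kappa>l[of k] unfolding \<epsilon>_def by linarith+
  have height: "\<kappa> * snd (\<zeta> k) \<le> snd x \<and> snd x \<le> 2 * snd (\<zeta> k)" if "x \<in> \<Delta> k" for x k
  proof -
    have "\<bar>(x - \<zeta> k) \<bullet> (0, 1)\<bar> \<le> l k / 2"
      using that snd_axis_in_Basis unfolding \<Delta> mem_axis_cube by blast
    then have "\<bar>snd x - snd (\<zeta> k)\<bar> \<le> l k / 2" by (simp add: snd_eq_inner inner_diff_left)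
    then show ?thesis using \<kappa>h[of k] mult_pos_pos[OF \<kappa> \<eta>[of k]] by arith
  qed
  define C' where "C' = 1 / (c * (\<kappa> / 8) powr d)"
  show ?thesis
  proof (intro exI[of _ C'] conjI allI impI)
    show "0 < C'" using c \<kappa> by (simp add: C'_def)
    fix f :: "(real ^ 'n) \<times> real \<Rightarrow> real" and z :: "nat \<Rightarrow> (real ^ 'n) \<times> real"
    assume f: "harmonic_on half_space f" and z: "\<forall>k. z k \<in> \<Delta> k"
    have cont: "continuous_on half_space f"
      using f by (simp add: harmonic_on_def C2_on_def C1_on_def)
    define G where "G w = ennreal_powr (\<integral>\<^sup>+x\<in>Q_cube w. ennreal (\<bar>f x\<bar> powr \<sigma> * snd x powr \<alpha>) \<partial>lborel) (q / \<sigma>)" for w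
    have "\<exists>c. box (c - (\<epsilon> k / 2) *\<^sub>R One) (c + (\<epsilon> k / 2) *\<^sub>R One) \<subseteq> interior (\<Delta> k) \<and>
        (\<forall>w b. w \<in> box (c - (\<epsilon> k / 2) *\<^sub>R One) (c + (\<epsilon> k / 2) *\<^sub>R One) \<longrightarrow> b \<in> Basis \<longrightarrow>
           \<bar>(w - z k) \<bullet> b\<bar> \<le> \<epsilon> k)" for k
    proof -
      have "z k \<in> axis_cube (\<zeta> k) (l k)" using z by (simp add: \<Delta>)
      from axis_cube_contract[OF this \<epsilon>] show ?thesis unfolding \<Delta> by metis
    qed
    then have "\<forall>k. \<exists>c. box (c - (\<epsilon> k / 2) *\<^sub>R One) (c + (\<epsilon> k / 2) *\<^sub>R One) \<subseteq> interior (\<Delta> k) \<and>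
        (\<forall>w b. w \<in> box (c - (\<epsilon> k / 2) *\<^sub>R One) (c + (\<epsilon> k / 2) *\<^sub>R One) \<longrightarrow> b \<in> Basis \<longrightarrow>
           \<bar>(w - z k) \<bullet> b\<bar> \<le> \<epsilon> k)" ..
    from choice[OF this] obtain x where xx: "\<forall>k. box (x k - (\<epsilon> k / 2) *\<^sub>R One) (x k + (\<epsilon> k / 2) *\<^sub>R One) \<subseteq> interior (\<Delta> k) \<and>
        (\<forall>w b. w \<in> box (x k - (\<epsilon> k / 2) *\<^sub>R One) (x k + (\<epsilon> k / 2) *\<^sub>R One) \<longrightarrow> b \<in> Basis \<longrightarrow>
           \<bar>(w - z k) \<bullet> b\<bar> \<le> \<epsilon> k)" ..
    have x: "box (x k - (\<epsilon> k / 2) *\<^sub>R One) (x k + (\<epsilon> k / 2) *\<^sub>R One) \<subseteq> interior (\<Delta> k)"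
      "w \<in> box (x k - (\<epsilon> k / 2) *\<^sub>R One) (x k + (\<epsilon> k / 2) *\<^sub>R One) \<Longrightarrow> b \<in> Basis \<Longrightarrow>
         \<bar>(w - z k) \<bullet> b\<bar> \<le> \<epsilon> k" for k w b
      using xx by blast+
    define W where "W k = box (x k - (\<epsilon> k / 2) *\<^sub>R One) (x k + (\<epsilon> k / 2) *\<^sub>R One)" for k
    have W\<Delta>: "W k \<subseteq> interior (\<Delta> k)" for k using x(1) by (simp add: W_def)
    define g where "g k = c * (snd (\<zeta> k) powr ((d + \<alpha>) * q / \<sigma>) * \<bar>f (z k)\<bar> powr q)" for k
    \<comment> \<open>Every \<open>Q_cube w\<close> with \<open>w\<close> in the small cube contains
      one and the same ball around \<open>z k\<close>; so the lower bound for \<open>G\<close> is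
      constant on \<open>W k\<close>.\<close>
    have gG: "ennreal (g k) \<le> G w" if w: "w \<in> W k" for k w
    proof -
      have "w \<in> \<Delta> k" using w W\<Delta> interior_subset by blast
      then have sw: "\<kappa> * snd (\<zeta> k) \<le> snd w" using height by blast
      have cube: "\<bar>(u - z k) \<bullet> b\<bar> \<le> \<epsilon> k" if "u \<in> cball (z k) (\<epsilon> k)" "b \<in> Basis" for u b
        using that Basis_le_norm[of b "u - z k"] by (simp add: dist_norm norm_minus_commute)
      have sub: "cball (z k) (\<epsilon> k) \<subseteq> Q_cube w"
      proof
        fix u assume u: "u \<in> cball (z k) (\<epsilon> k)"
        show "u \<in> Q_cube w"
          unfolding Q_cube_def mem_axis_cube
        proof
          fix b :: "(real ^ 'n) \<times> real" assume b: "b \<in> Basis"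
          have "(u - w) \<bullet> b = (u - z k) \<bullet> b - (w - z k) \<bullet> b" by (simp add: inner_diff_left)
          then have "\<bar>(u - w) \<bullet> b\<bar> \<le> 2 * \<epsilon> k"
            using cube[OF u b] x(2)[OF w[unfolded W_def] b] by arith
          then show "\<bar>(u - w) \<bullet> b\<bar> \<le> snd w / 2"
            using sw mult_pos_pos[OF \<kappa> \<eta>[of k]] by (simp add: \<epsilon>_def)
        qed
      qed
      have heights: "\<kappa> / 2 * snd (\<zeta> k) \<le> snd u \<and> snd u \<le> 3 * snd (\<zeta> k)" if u: "u \<in> cball (z k) (\<epsilon> k)" for u
      proof -
        have "\<bar>snd u - snd (z k)\<bar> \<le> \<epsilon> k"
          using cube[OF u snd_axis_in_Basis] by (simp add: snd_eq_inner inner_diff_left)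
        moreover have "\<kappa> * snd (\<zeta> k) \<le> snd (z k) \<and> snd (z k) \<le> 2 * snd (\<zeta> k)"
          using height z by blast
        moreover have "\<kappa> * snd (\<zeta> k) \<le> snd (\<zeta> k)" using \<kappa>h[of k] l[of k] by simp
        moreover have "0 < \<kappa> * snd (\<zeta> k)" using \<kappa> \<eta> by simp
        moreover have "\<epsilon> k = \<kappa> * snd (\<zeta> k) / 8" "\<kappa> / 2 * snd (\<zeta> k) = \<kappa> * snd (\<zeta> k) / 2"
          by (simp_all add: \<epsilon>_def)
        ultimately show ?thesis by linarith
      qed
      have "cball (z k) (\<epsilon> k) \<subseteq> half_space"
      proof
        fix u assume u: "u \<in> cball (z k) (\<epsilon> k)"
        have "0 < \<kappa> / 2 * snd (\<zeta> k)" using \<kappa> \<eta> by simp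
        then show "u \<in> half_space"
          unfolding half_space_def mem_Collect_eq using heights[OF u] by linarith
      qed
      from avg[OF open_half_space f \<epsilon>(1) this]
      show ?thesis
        unfolding g_def c_def G_def d_def
        by (rule ennreal_powr_weighted_integral_ge[OF \<sigma> q \<kappa> cont C _ \<eta> \<epsilon>_def heights sub])
    qed
    have "ennreal (snd (\<zeta> k) powr (d + (d + \<alpha>) * q / \<sigma>) * \<bar>f (z k)\<bar> powr q) =
        ennreal C' * (ennreal (g k) * emeasure lborel (W k))" for k
    proof -
      have "emeasure lborel (W k) = ennreal (\<epsilon> k ^ ?d)"
        unfolding W_def using \<epsilon>(1)[of k] by (intro emeasure_box_One) simp
      also have "\<epsilon> k ^ ?d = (\<kappa> / 8) powr d * snd (\<zeta> k) powr d"
        using power_mult_distrib[of "\<kappa> / 8" "snd (\<zeta> k)" ?d] \<kappa> \<eta>[of k] pw[of "\<kappa> / 8"] pw[of "snd (\<zeta> k)"]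
        by (simp only: \<epsilon>_def times_divide_eq_left)
      finally have "ennreal C' * (ennreal (g k) * emeasure lborel (W k)) =
          ennreal (C' * (g k * ((\<kappa> / 8) powr d * snd (\<zeta> k) powr d)))"
        using \<open>0 < C'\<close> c by (simp add: ennreal_mult' g_def)
      also have "C' * (g k * ((\<kappa> / 8) powr d * snd (\<zeta> k) powr d)) =
          snd (\<zeta> k) powr (d + (d + \<alpha>) * q / \<sigma>) * \<bar>f (z k)\<bar> powr q"
        using c \<kappa> by (simp add: C'_def g_def powr_add)
      finally show ?thesis by simp
    qed
    then have eq: "(\<Sum>k. ennreal (snd (\<zeta> k) powr (d + (d + \<alpha>) * q / \<sigma>) * \<bar>f (z k)\<bar> powr q)) =
        ennreal C' * (\<Sum>k. ennreal (g k) * emeasure lborel (W k))" by simp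
    have "(\<Sum>k. ennreal (g k) * emeasure lborel (W k)) \<le> (\<integral>\<^sup>+w\<in>half_space. G w \<partial>lborel)"
    proof -
      have Wm: "W k \<in> sets lborel" for k by (simp add: W_def)
      \<comment> \<open>The sum is the integral of a step function below \<open>G\<close>. The
        comparison is pointwise, so measurability of \<open>G\<close> never comes into
        question.\<close>
      have "(\<Sum>k. ennreal (g k) * emeasure lborel (W k)) =
          (\<integral>\<^sup>+w. (\<Sum>k. ennreal (g k) * indicator (W k) w) \<partial>lborel)"
        using nn_integral_suminf[of "\<lambda>k w. ennreal (g k) * indicator (W k) w" lborel]
        by (simp only: nn_integral_cmult_indicator[OF Wm] borel_measurable_times_ennreal
            borel_measurable_const borel_measurable_indicator[OF Wm])
      also have "\<dots> \<le> (\<integral>\<^sup>+w\<in>half_space. G w \<partial>lborel)"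
      proof (rule nn_integral_mono)
        fix w
        show "(\<Sum>k. ennreal (g k) * indicator (W k) w) \<le> G w * indicator half_space w"
        proof (cases "\<exists>k. w \<in> W k")
          case True
          then obtain k where k: "w \<in> W k" by blast
          have "w \<notin> W j" if "j \<noteq> k" for j
            using k W\<Delta>[of j] W\<Delta>[of k] disj[OF that] by blast
          then have "(\<Sum>k. ennreal (g k) * indicator (W k) w) = (\<Sum>k\<in>{k}. ennreal (g k) * indicator (W k) w)"
            by (intro suminf_finite) auto
          also have "\<dots> = ennreal (g k)" using k by simp
          also have "\<dots> \<le> G w" by (rule gG[OF k])
          finally have "(\<Sum>k. ennreal (g k) * indicator (W k) w) \<le> G w" .
          moreover have "w \<in> half_space"
            using k W\<Delta>[of k] interior_subset[of "\<Delta> k"] union by blast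
          ultimately show ?thesis by simp
        next
          case False
          then show ?thesis by simp
        qed
      qed
      finally show ?thesis .
    qed
    then show "(\<Sum>k. ennreal (snd (\<zeta> k) powr (d + (d + \<alpha>) * q / \<sigma>) * \<bar>f (z k)\<bar> powr q)) \<le>
        ennreal C' * (\<integral>\<^sup>+w\<in>half_space. ennreal_powr
          (\<integral>\<^sup>+x\<in>Q_cube w. ennreal (\<bar>f x\<bar> powr \<sigma> * snd x powr \<alpha>) \<partial>lborel) (q / \<sigma>) \<partial>lborel)"
      unfolding eq G_def by (rule mult_left_mono) simp
  qed
qed

section \<open>Upper bounds for functions with a pole below the boundary\<close>

text \<open>On \<open>Q_cube w\<close> the distance to the pole is at least a fixed fraction of
  \<open>norm (w - a)\<close>, which bounds the inner integral by a power of the height of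
  \<open>w\<close> times a power of that distance. The height is at most the distance and
  \<open>\<beta> \<ge> 0\<close>, so height can be traded for distance; what remains is integrable
  away from the pole by \<open>decay\<close>. One constant serves all poles and depths.\<close>

lemma test_function_integral_le:
  fixes \<alpha> :: real
  assumes \<sigma>: "0 < \<sigma>" and q: "0 < q" and N: "0 \<le> N"
  defines "d \<equiv> real DIM((real ^ 'n) \<times> real)"
  defines "\<beta> \<equiv> (d + \<alpha>) * q / \<sigma>"
  assumes \<beta>: "0 \<le> \<beta>" and decay: "d < N * q - \<beta>"
  shows "\<exists>C>0. \<forall>(f :: (real ^ 'n) \<times> real \<Rightarrow> real) a \<rho>. 0 < \<rho> \<longrightarrow> snd a = - \<rho> \<longrightarrow>
    (\<forall>z. \<bar>f z\<bar> \<le> norm (z - a) powr - N) \<longrightarrow>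
    (\<integral>\<^sup>+w\<in>half_space. ennreal_powr
      (\<integral>\<^sup>+x\<in>Q_cube w. ennreal (\<bar>f x\<bar> powr \<sigma> * snd x powr \<alpha>) \<partial>lborel) (q / \<sigma>) \<partial>lborel)
    \<le> ennreal (C * \<rho> powr (d + \<beta> - N * q))"
proof -
  let ?d = "DIM((real ^ 'n) \<times> real)"
  obtain C0 where C0: "0 < C0" and tail: "\<And>(a :: (real ^ 'n) \<times> real) \<rho>. 0 < \<rho> \<Longrightarrow>
    (\<integral>\<^sup>+u\<in>- ball a \<rho>. ennreal (norm (u - a) powr - (N * q - \<beta>)) \<partial>lborel) \<le>
      ennreal (C0 * \<rho> powr (d - (N * q - \<beta>)))"
    using nn_integral_norm_powr_outside_ball[OF decay[unfolded d_def]] unfolding d_def by blast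
  \<comment> \<open>For \<open>x\<close> in \<open>Q_cube w\<close>, \<open>norm (x - w)\<close> is
    at most half the height of \<open>w\<close> times \<open>norm One\<close>, and that half height
    is at most \<open>norm (x - a)\<close>. The triangle inequality then gives
    \<open>norm (w - a) \<le> \<nu> * norm (x - a)\<close>.\<close>
  define \<nu> where "\<nu> = 1 + norm (One :: (real ^ 'n) \<times> real)"
  have \<nu>: "1 \<le> \<nu>" by (simp add: \<nu>_def)
  \<comment> \<open>Heights in \<open>Q_cube w\<close> lie between 1/2 and 3/2 of the height of
    \<open>w\<close>.\<close>
  define M where "M = max ((1 / 2) powr \<alpha>) ((3 / 2) powr \<alpha>)"
  have M: "0 < M" by (simp add: M_def less_max_iff_disj)
  define c where "c = \<nu> powr (N * \<sigma>) * M"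
  have c: "0 < c" using \<nu> M by (simp add: c_def)
  define C where "C = c powr (q / \<sigma>) * C0"
  show ?thesis
  proof (intro exI[of _ C] conjI allI impI)
    show "0 < C" using c C0 by (simp add: C_def)
    fix f :: "(real ^ 'n) \<times> real \<Rightarrow> real" and a and \<rho> :: real
    assume \<rho>: "0 < \<rho>" and a: "snd a = - \<rho>" and f: "\<forall>z. \<bar>f z\<bar> \<le> norm (z - a) powr - N"
    have ptwise: "ennreal_powr (\<integral>\<^sup>+x\<in>Q_cube w. ennreal (\<bar>f x\<bar> powr \<sigma> * snd x powr \<alpha>) \<partial>lborel) (q / \<sigma>) \<le>
        ennreal (c powr (q / \<sigma>)) * ennreal (norm (w - a) powr - (N * q - \<beta>)) \<and> w \<notin> ball a \<rho>"
      if w: "w \<in> half_space" for w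
    proof -
      define s where "s = snd w"
      have s: "0 < s" using w by (simp add: s_def half_space_def)
      \<comment> \<open>The vertical gap between \<open>w\<close> and the pole. It yields both that
        the half space avoids the ball of radius \<rho> and that the height is at most the
        distance.\<close>
      have "s + \<rho> \<le> norm (w - a)" using abs_snd_le_norm[of "w - a"] a by (simp add: s_def)
      then have far: "\<rho> \<le> norm (w - a)" and sn: "s \<le> norm (w - a)" and pos: "0 < norm (w - a)"
        using s \<rho> by linarith+
      define R where "R = norm (w - a)"
      define B where "B = c * (s powr \<alpha> * R powr (- (N * \<sigma>)))"
      have B: "0 \<le> B" using c by (simp add: B_def)
      have pt: "\<bar>f x\<bar> powr \<sigma> * snd x powr \<alpha> \<le> B" if x: "x \<in> Q_cube w" for x
      proof -
        have cube: "\<bar>(x - w) \<bullet> b\<bar> \<le> s / 2" if "b \<in> Basis" for b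
          using x that by (simp add: Q_cube_def mem_axis_cube s_def)
        have sx: "\<bar>snd x - s\<bar> \<le> s / 2"
          using cube[OF snd_axis_in_Basis] by (simp add: snd_eq_inner inner_diff_left s_def)
        have xa: "snd x + \<rho> \<le> norm (x - a)" using abs_snd_le_norm[of "x - a"] a by simp
        have half: "s / 2 \<le> norm (x - a)" using sx xa \<rho> by arith
        have "norm (x - w) \<le> s / 2 * norm (One :: (real ^ 'n) \<times> real)"
          using cube s by (intro norm_le_norm_One) auto
        also have "\<dots> \<le> norm (x - a) * norm (One :: (real ^ 'n) \<times> real)"
          using half by (rule mult_right_mono) simp
        finally have "R \<le> \<nu> * norm (x - a)"
          using norm_triangle_ineq4[of "x - a" "x - w"] by (simp add: R_def \<nu>_def algebra_simps)
        then have Rx: "R / \<nu> \<le> norm (x - a)" using \<nu> by (simp add: field_simps)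
        have "\<bar>f x\<bar> powr \<sigma> \<le> (norm (x - a) powr - N) powr \<sigma>"
          using f[rule_format, of x] \<sigma> by (intro powr_mono2) simp_all
        also have "\<dots> = norm (x - a) powr (- (N * \<sigma>))" by (simp add: powr_powr)
        also have "\<dots> \<le> (R / \<nu>) powr (- (N * \<sigma>))"
          using Rx N \<sigma> pos \<nu> by (intro powr_mono2') (auto simp: R_def)
        also have "\<dots> = \<nu> powr (N * \<sigma>) * R powr (- (N * \<sigma>))"
          using \<nu> pos by (simp add: R_def powr_divide powr_minus field_simps)
        finally have 1: "\<bar>f x\<bar> powr \<sigma> \<le> \<nu> powr (N * \<sigma>) * R powr (- (N * \<sigma>))" .
        define t where "t = snd x / s"
        have "s / 2 \<le> snd x" "snd x \<le> 3 / 2 * s" using sx by arith+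
        then have "1 / 2 \<le> t" "t \<le> 3 / 2" using s by (simp_all add: t_def field_simps)
        then have "t powr \<alpha> \<le> M" unfolding M_def by (intro powr_le_max) auto
        then have "t powr \<alpha> * s powr \<alpha> \<le> M * s powr \<alpha>" by (intro mult_right_mono) auto
        moreover have "t powr \<alpha> * s powr \<alpha> = snd x powr \<alpha>" using s by (simp add: t_def flip: powr_mult)
        ultimately have 2: "snd x powr \<alpha> \<le> M * s powr \<alpha>" by simp
        have "\<bar>f x\<bar> powr \<sigma> * snd x powr \<alpha> \<le> (\<nu> powr (N * \<sigma>) * R powr (- (N * \<sigma>))) * (M * s powr \<alpha>)"
          using 1 2 by (intro mult_mono) auto
        then show ?thesis by (simp add: B_def c_def mult.commute mult.left_commute)
      qed
      have "(\<integral>\<^sup>+x\<in>Q_cube w. ennreal (\<bar>f x\<bar> powr \<sigma> * snd x powr \<alpha>) \<partial>lborel) \<le>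
          (\<integral>\<^sup>+x. ennreal B * indicator (Q_cube w) x \<partial>lborel)"
        using pt by (intro nn_integral_mono) (auto simp: indicator_def intro: ennreal_leI)
      also have "\<dots> = ennreal B * emeasure lborel (Q_cube w)"
        by (rule nn_integral_cmult_indicator) (simp add: Q_cube_def axis_cube_def)
      also have "emeasure lborel (Q_cube w) = ennreal (s ^ ?d)"
        unfolding Q_cube_def s_def[symmetric] using s by (intro emeasure_axis_cube) simp
      also have "ennreal B * ennreal (s ^ ?d) = ennreal (B * s ^ ?d)"
        using B by (rule ennreal_mult'[symmetric])
      also have "B * s ^ ?d = c * (s powr (d + \<alpha>) * R powr (- (N * \<sigma>)))"
        using s by (simp add: B_def d_def powr_add powr_realpow)
      finally have "ennreal_powr (\<integral>\<^sup>+x\<in>Q_cube w. ennreal (\<bar>f x\<bar> powr \<sigma> * snd x powr \<alpha>) \<partial>lborel) (q / \<sigma>) \<le>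
          ennreal_powr (ennreal (c * (s powr (d + \<alpha>) * R powr (- (N * \<sigma>))))) (q / \<sigma>)"
        using \<sigma> q by (intro ennreal_powr_mono) auto
      also have "\<dots> = ennreal (c powr (q / \<sigma>) * (s powr \<beta> * R powr (- (N * q))))"
        using c \<sigma> by (subst ennreal_powr_ennreal) (auto simp: powr_mult powr_powr \<beta>_def)
      also have "\<dots> \<le> ennreal (c powr (q / \<sigma>) * (R powr \<beta> * R powr (- (N * q))))"
        using sn s \<beta> by (intro ennreal_leI mult_left_mono mult_right_mono powr_mono2) (auto simp: R_def)
      also have "\<dots> = ennreal (c powr (q / \<sigma>)) * ennreal (R powr - (N * q - \<beta>))"
        by (simp add: ennreal_mult' flip: powr_add)
      finally show ?thesis using far by (simp add: R_def dist_norm norm_minus_commute)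
    qed
    have "(\<integral>\<^sup>+w\<in>half_space. ennreal_powr
        (\<integral>\<^sup>+x\<in>Q_cube w. ennreal (\<bar>f x\<bar> powr \<sigma> * snd x powr \<alpha>) \<partial>lborel) (q / \<sigma>) \<partial>lborel) \<le>
      (\<integral>\<^sup>+w. ennreal (c powr (q / \<sigma>)) *
        (ennreal (norm (w - a) powr - (N * q - \<beta>)) * indicator (- ball a \<rho>) w) \<partial>lborel)"
      by (rule nn_integral_mono) (use ptwise in \<open>auto simp: indicator_def\<close>)
    also have "\<dots> = ennreal (c powr (q / \<sigma>)) *
        (\<integral>\<^sup>+u\<in>- ball a \<rho>. ennreal (norm (u - a) powr - (N * q - \<beta>)) \<partial>lborel)"
      by (rule nn_integral_cmult) measurable
    also have "\<dots> \<le> ennreal (c powr (q / \<sigma>)) * ennreal (C0 * \<rho> powr (d - (N * q - \<beta>)))"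
      by (intro mult_left_mono tail \<rho>) simp
    also have "\<dots> = ennreal (C * \<rho> powr (d + \<beta> - N * q))"
      using C0 by (simp add: C_def ennreal_mult' algebra_simps)
    finally show "(\<integral>\<^sup>+w\<in>half_space. ennreal_powr
        (\<integral>\<^sup>+x\<in>Q_cube w. ennreal (\<bar>f x\<bar> powr \<sigma> * snd x powr \<alpha>) \<partial>lborel) (q / \<sigma>) \<partial>lborel) \<le>
      ennreal (C * \<rho> powr (d + \<beta> - N * q))" .
  qed
qed

section \<open>The equivalence\<close>

lemma whitney_max_exists:
  fixes \<Delta> :: "nat \<Rightarrow> ((real ^ 'n) \<times> real) set"
  assumes W: "whitney_decomposition \<Delta> \<zeta>" and f: "harmonic_on half_space f"
  shows "\<exists>z. \<forall>k. z k \<in> \<Delta> k \<and> (\<forall>x\<in>\<Delta> k. \<bar>f x\<bar> \<le> \<bar>f (z k)\<bar>)"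
proof (rule choice, rule allI)
  fix k
  obtain l where l: "0 < l" "\<Delta> k = axis_cube (\<zeta> k) l"
    using whitney_decomposition_cube[OF W] by blast
  have "\<Delta> k \<subseteq> half_space" using W by (auto simp: whitney_decomposition_def)
  moreover have "continuous_on half_space f"
    using f by (simp add: harmonic_on_def C2_on_def C1_on_def)
  ultimately have "continuous_on (\<Delta> k) (\<lambda>x. \<bar>f x\<bar>)"
    by (auto intro!: continuous_intros intro: continuous_on_subset)
  moreover have "compact (\<Delta> k)" by (simp add: l axis_cube_def compact_cbox)
  moreover have "\<zeta> k \<in> \<Delta> k" using l by (simp add: mem_axis_cube)
  ultimately show "\<exists>z. z \<in> \<Delta> k \<and> (\<forall>x\<in>\<Delta> k. \<bar>f x\<bar> \<le> \<bar>f z\<bar>)"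
    using continuous_attains_sup[of "\<Delta> k" "\<lambda>x. \<bar>f x\<bar>"] by blast
qed

text \<open>Replacing each function by its maximum on the cube leaves only the measure of the cube.
  Its bound, raised to the power \<open>q / p\<close>, splits into one height power
  \<open>e i\<close> per function, exactly the weight with which the maxima are summable. Different
  functions may have different maximisers, hence the family \<open>z i k\<close>.\<close>

lemma A_norm_powr_le:
  fixes \<Delta> :: "nat \<Rightarrow> ((real ^ 'n) \<times> real) set" and \<sigma> \<alpha> :: "nat \<Rightarrow> real" and m :: nat
  assumes W: "whitney_decomposition \<Delta> \<zeta>" and p: "0 < p" and q: "0 < q" and m: "1 \<le> m"
    and \<sigma>: "\<And>i. i \<in> {1..m} \<Longrightarrow> 0 < \<sigma> i"
    and \<Delta>\<mu>: "\<And>k. \<Delta> k \<in> sets \<mu>"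
  defines "d \<equiv> real DIM((real ^ 'n) \<times> real)"
  assumes C: "0 < C" and \<mu>: "\<And>k. emeasure \<mu> (\<Delta> k) \<le>
      ennreal (C * snd (\<zeta> k) powr (p / q * (\<Sum>i=1..m. d + (d + \<alpha> i) * q / \<sigma> i)))"
  shows "\<exists>C>0. \<forall>f. (\<forall>i\<in>{1..m}. harmonic_on half_space (f i)) \<longrightarrow>
    A_norm_powr \<Delta> p q m \<mu> f \<le> ennreal C *
      (\<Prod>i=1..m. \<integral>\<^sup>+w\<in>half_space. ennreal_powr
        (\<integral>\<^sup>+z\<in>Q_cube w. ennreal (\<bar>f i z\<bar> powr \<sigma> i * snd z powr \<alpha> i) \<partial>lborel) (q / \<sigma> i) \<partial>lborel)"
proof -
  define I where "I f i = (\<integral>\<^sup>+w\<in>half_space. ennreal_powr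
      (\<integral>\<^sup>+z\<in>Q_cube w. ennreal (\<bar>f z\<bar> powr \<sigma> i * snd z powr \<alpha> i) \<partial>lborel) (q / \<sigma> i) \<partial>lborel)"
    for f :: "(real ^ 'n) \<times> real \<Rightarrow> real" and i
  define e where "e i = d + (d + \<alpha> i) * q / \<sigma> i" for i
  have "\<forall>i\<in>{1..m}. \<exists>c>0. \<forall>f z. harmonic_on half_space f \<longrightarrow> (\<forall>k. z k \<in> \<Delta> k) \<longrightarrow>
    (\<Sum>k. ennreal (snd (\<zeta> k) powr e i * \<bar>f (z k)\<bar> powr q)) \<le> ennreal c * I f i"
    unfolding I_def e_def d_def using whitney_suminf_le_integral[OF W \<sigma> q] by blast
  from bchoice[OF this] obtain c where c: "\<And>i. i \<in> {1..m} \<Longrightarrow> 0 < c i"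
    and sum_le: "\<And>i f z. i \<in> {1..m} \<Longrightarrow> harmonic_on half_space f \<Longrightarrow> (\<And>k. z k \<in> \<Delta> k) \<Longrightarrow>
      (\<Sum>k. ennreal (snd (\<zeta> k) powr e i * \<bar>f (z k)\<bar> powr q)) \<le> ennreal (c i) * I f i"
    by blast
  have \<eta>: "0 < snd (\<zeta> k)" for k
    by (rule whitney_decomposition_scale[OF W]) blast
  define C' where "C' = C powr (q / p) * (\<Prod>i=1..m. c i)"
  have "0 < (\<Prod>i=1..m. c i)" using c by (rule prod_pos)
  then have C': "0 < C'" using C by (simp add: C'_def)
  have main: "A_norm_powr \<Delta> p q m \<mu> f \<le> ennreal C' * (\<Prod>i=1..m. I (f i) i)"
    if f: "\<forall>i\<in>{1..m}. harmonic_on half_space (f i)" for f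
  proof -
    have "\<forall>i\<in>{1..m}. \<exists>z. \<forall>k. z k \<in> \<Delta> k \<and> (\<forall>x\<in>\<Delta> k. \<bar>f i x\<bar> \<le> \<bar>f i (z k)\<bar>)"
      using whitney_max_exists[OF W] f by blast
    from bchoice[OF this] obtain z where z: "\<And>i k. i \<in> {1..m} \<Longrightarrow> z i k \<in> \<Delta> k"
      and z_max: "\<And>i k x. i \<in> {1..m} \<Longrightarrow> x \<in> \<Delta> k \<Longrightarrow> \<bar>f i x\<bar> \<le> \<bar>f i (z i k)\<bar>" by blast
    define a where "a i k = snd (\<zeta> k) powr e i * \<bar>f i (z i k)\<bar> powr q" for i k
    have term_le: "ennreal_powr (\<integral>\<^sup>+x\<in>\<Delta> k. ennreal (\<Prod>i=1..m. \<bar>f i x\<bar> powr p) \<partial>\<mu>) (q / p) \<le>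
        ennreal (C powr (q / p)) * (\<Prod>i=1..m. ennreal (a i k))" for k
    proof -
      define P where "P = (\<Prod>i=1..m. \<bar>f i (z i k)\<bar> powr p)"
      define X where "X = C * snd (\<zeta> k) powr (p / q * (\<Sum>i=1..m. e i))"
      have P: "0 \<le> P" by (simp add: P_def prod_nonneg)
      have "(\<integral>\<^sup>+x\<in>\<Delta> k. ennreal (\<Prod>i=1..m. \<bar>f i x\<bar> powr p) \<partial>\<mu>) \<le> (\<integral>\<^sup>+x. ennreal P * indicator (\<Delta> k) x \<partial>\<mu>)"
      proof (rule nn_integral_mono)
        fix x
        show "ennreal (\<Prod>i=1..m. \<bar>f i x\<bar> powr p) * indicator (\<Delta> k) x \<le> ennreal P * indicator (\<Delta> k) x"
        proof (cases "x \<in> \<Delta> k")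
          case True
          have "(\<Prod>i=1..m. \<bar>f i x\<bar> powr p) \<le> P"
            unfolding P_def using p z_max[OF _ True] by (intro prod_mono) (auto intro: powr_mono2)
          then show ?thesis using True by (simp add: ennreal_leI)
        qed simp
      qed
      also have "\<dots> = ennreal P * emeasure \<mu> (\<Delta> k)"
        using \<Delta>\<mu> by (rule nn_integral_cmult_indicator)
      also have "\<dots> \<le> ennreal P * ennreal X"
        unfolding X_def e_def by (intro mult_left_mono \<mu>) simp
      also have "\<dots> = ennreal (P * X)" using P by (rule ennreal_mult'[symmetric])
      finally have "ennreal_powr (\<integral>\<^sup>+x\<in>\<Delta> k. ennreal (\<Prod>i=1..m. \<bar>f i x\<bar> powr p) \<partial>\<mu>) (q / p) \<le>
          ennreal_powr (ennreal (P * X)) (q / p)"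
        using p q by (intro ennreal_powr_mono) auto
      also have "\<dots> = ennreal (P powr (q / p) * X powr (q / p))"
        using P C by (subst ennreal_powr_ennreal) (auto simp: X_def powr_mult)
      also have "P powr (q / p) = (\<Prod>i=1..m. \<bar>f i (z i k)\<bar> powr q)"
        unfolding P_def prod_powr_distrib using p by (simp add: powr_powr)
      also have "X powr (q / p) = C powr (q / p) * (\<Prod>i=1..m. snd (\<zeta> k) powr e i)"
      proof -
        have eq: "p / q * (\<Sum>i=1..m. e i) * (q / p) = (\<Sum>i=1..m. e i)" using p q by simp
        show ?thesis
          unfolding X_def powr_mult powr_powr eq using \<eta>[of k] by (simp add: powr_sum)
      qed
      also have "(\<Prod>i=1..m. \<bar>f i (z i k)\<bar> powr q) * (C powr (q / p) * (\<Prod>i=1..m. snd (\<zeta> k) powr e i)) =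
          C powr (q / p) * (\<Prod>i=1..m. a i k)"
        by (simp add: a_def prod.distrib)
      also have "ennreal (C powr (q / p) * (\<Prod>i=1..m. a i k)) =
          ennreal (C powr (q / p)) * (\<Prod>i=1..m. ennreal (a i k))"
        by (subst prod_ennreal) (auto simp: a_def ennreal_mult')
      finally show ?thesis .
    qed
    have "A_norm_powr \<Delta> p q m \<mu> f \<le> (\<Sum>k. ennreal (C powr (q / p)) * (\<Prod>i=1..m. ennreal (a i k)))"
      unfolding A_norm_powr_def by (intro suminf_le term_le summableI)
    also have "\<dots> = ennreal (C powr (q / p)) * (\<Sum>k. \<Prod>i=1..m. ennreal (a i k))" by simp
    also have "\<dots> \<le> ennreal (C powr (q / p)) * (\<Prod>i=1..m. \<Sum>k. ennreal (a i k))"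
      using m by (intro mult_left_mono suminf_prod_le_prod_suminf) auto
    also have "\<dots> \<le> ennreal (C powr (q / p)) * (\<Prod>i=1..m. ennreal (c i) * I (f i) i)"
      unfolding a_def by (intro mult_left_mono prod_mono_ennreal sum_le) (use f z in \<open>simp_all\<close>)
    also have "\<dots> = ennreal C' * (\<Prod>i=1..m. I (f i) i)"
    proof -
      have "(\<Prod>i=1..m. ennreal (c i)) = ennreal (\<Prod>i=1..m. c i)"
        using c by (intro prod_ennreal) (auto intro: less_imp_le)
      then show ?thesis by (simp add: prod.distrib C'_def ennreal_mult' mult.assoc)
    qed
    finally show ?thesis .
  qed
  then show ?thesis using C' unfolding I_def by blast
qed

text \<open>The test function is at least \<open>\<rho> powr - N / 2\<close> on the cube, and the
  right side of the norm inequality is of order \<open>\<rho> powr (E - N * q * m)\<close>. The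
  powers containing \<open>N\<close> balance, and \<open>E\<close> survives.\<close>

lemma emeasure_whitney_le:
  fixes \<Delta> :: "nat \<Rightarrow> ((real ^ 'n) \<times> real) set" and \<sigma> \<alpha> :: "nat \<Rightarrow> real" and m :: nat
  assumes W: "whitney_decomposition \<Delta> \<zeta>" and p: "0 < p" and q: "0 < q"
    and \<sigma>: "\<And>i. i \<in> {1..m} \<Longrightarrow> 0 < \<sigma> i" and \<alpha>: "\<And>i. i \<in> {1..m} \<Longrightarrow> -1 < \<alpha> i"
    and \<Delta>\<mu>: "\<And>k. \<Delta> k \<in> sets \<mu>"
  defines "d \<equiv> real DIM((real ^ 'n) \<times> real)"
  assumes C: "0 < C" and norm_le: "\<And>f. (\<forall>i\<in>{1..m}. harmonic_on half_space (f i)) \<Longrightarrow>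
    A_norm_powr \<Delta> p q m \<mu> f \<le> ennreal C *
      (\<Prod>i=1..m. \<integral>\<^sup>+w\<in>half_space. ennreal_powr
        (\<integral>\<^sup>+z\<in>Q_cube w. ennreal (\<bar>f i z\<bar> powr \<sigma> i * snd z powr \<alpha> i) \<partial>lborel) (q / \<sigma> i) \<partial>lborel)"
  shows "\<exists>C>0. \<forall>k. emeasure \<mu> (\<Delta> k) \<le>
      ennreal (C * snd (\<zeta> k) powr (p / q * (\<Sum>i=1..m. d + (d + \<alpha> i) * q / \<sigma> i)))"
proof -
  define I where "I f i = (\<integral>\<^sup>+w\<in>half_space. ennreal_powr
      (\<integral>\<^sup>+z\<in>Q_cube w. ennreal (\<bar>f z\<bar> powr \<sigma> i * snd z powr \<alpha> i) \<partial>lborel) (q / \<sigma> i) \<partial>lborel)"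
    for f :: "(real ^ 'n) \<times> real \<Rightarrow> real" and i
  define \<beta> where "\<beta> i = (d + \<alpha> i) * q / \<sigma> i" for i
  have d: "2 \<le> DIM((real ^ 'n) \<times> real)" "2 \<le> d" by (simp_all add: d_def Suc_leI)
  have \<beta>: "0 \<le> \<beta> i" if "i \<in> {1..m}" for i
    using \<sigma>[OF that] \<alpha>[OF that] q d by (simp add: \<beta>_def)
  \<comment> \<open>One function serves all \<open>i\<close>, so \<open>N * q\<close> must exceed
    \<open>d + \<beta> i\<close> for each of them. A sum of nonnegative terms dominates every term,
    and the extra 1 makes the inequality strict.\<close>
  define N0 where "N0 = (\<Sum>i=1..m. (d + 1 + \<beta> i) / q)"
  obtain N \<delta> and K :: "(real ^ 'n) \<times> real \<Rightarrow> real" where N0: "N0 \<le> N" and \<delta>: "0 < \<delta>"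
    and K_harm: "\<And>S a. open S \<Longrightarrow> a \<notin> S \<Longrightarrow> harmonic_on S (\<lambda>z. K (z - a))"
    and K_le: "\<And>z. \<bar>K z\<bar> \<le> norm z powr - N"
    and K_ge: "\<And>c u. 0 < c \<Longrightarrow> norm (u - (0, 1)) < \<delta> \<Longrightarrow> c powr - N / 2 \<le> K (c *\<^sub>R u)"
    by (rule harmonic_test_function_exists[OF snd_axis_in_Basis d(1)]) (rule that)
  have nonneg: "0 \<le> (d + 1 + \<beta> i) / q" if "i \<in> {1..m}" for i
    using \<beta>[OF that] d q by simp
  have "0 \<le> N0" unfolding N0_def by (rule sum_nonneg) (rule nonneg)
  then have N: "0 \<le> N" using N0 by simp
  have decay: "d < N * q - \<beta> i" if i: "i \<in> {1..m}" for i
  proof -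
    have "(d + 1 + \<beta> i) / q \<le> N0"
      unfolding N0_def using nonneg i by (intro member_le_sum) auto
    then have "d + 1 + \<beta> i \<le> N * q" using N0 q by (simp add: pos_divide_le_eq) (meson mult_right_mono less_imp_le order.trans)
    then show ?thesis by simp
  qed
  have "\<forall>i\<in>{1..m}. \<exists>c>0. \<forall>(f :: (real ^ 'n) \<times> real \<Rightarrow> real) a \<rho>. 0 < \<rho> \<longrightarrow> snd a = - \<rho> \<longrightarrow>
      (\<forall>z. \<bar>f z\<bar> \<le> norm (z - a) powr - N) \<longrightarrow> I f i \<le> ennreal (c * \<rho> powr (d + \<beta> i - N * q))"
    unfolding I_def \<beta>_def d_def
    using test_function_integral_le[OF \<sigma> q N] \<beta> decay unfolding \<beta>_def d_def by blast
  from bchoice[OF this] obtain c where c: "\<And>i. i \<in> {1..m} \<Longrightarrow> 0 < c i"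
    and I_le: "\<And>i (f :: (real ^ 'n) \<times> real \<Rightarrow> real) a \<rho>. i \<in> {1..m} \<Longrightarrow> 0 < \<rho> \<Longrightarrow> snd a = - \<rho> \<Longrightarrow>
      (\<And>z. \<bar>f z\<bar> \<le> norm (z - a) powr - N) \<Longrightarrow> I f i \<le> ennreal (c i * \<rho> powr (d + \<beta> i - N * q))"
    by blast
  obtain \<kappa> l where \<kappa>: "0 < \<kappa>"
    and \<Delta>: "\<And>k. \<Delta> k = axis_cube (\<zeta> k) (l k)" and l: "\<And>k. 0 < l k" and \<eta>: "\<And>k. 0 < snd (\<zeta> k)"
    and "\<And>k. \<kappa> * snd (\<zeta> k) \<le> l k" and \<kappa>h: "\<And>k. \<kappa> * snd (\<zeta> k) \<le> snd (\<zeta> k) - l k / 2"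
    by (rule whitney_decomposition_scale[OF W]) (rule that)
  define \<nu> where "\<nu> = norm (One :: (real ^ 'n) \<times> real)"
  \<comment> \<open>A pole far below \<open>\<Delta> k\<close>: seen from it, \<open>\<Delta> k\<close> lies so close to the vertical axis that the
    Kelvin transform has no zeros there.\<close>
  define L where "L = (\<nu> + 1) / \<delta> + 1"
  have L: "0 < L" using \<delta> by (auto simp: L_def \<nu>_def intro!: add_nonneg_pos divide_nonneg_pos)
  define E where "E = (\<Sum>i=1..m. d + \<beta> i)"
  \<comment> \<open>Collects the loss from the factor 1/2 in the lower bound, the constants of the
    norm inequality and of the outer integrals, and \<open>L powr E\<close> from passing from \<rho>
    to the height of the centre.\<close>
  define B where "B = 2 powr (q * m) * C * (\<Prod>i=1..m. c i) * L powr E"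
  have cprod: "0 < (\<Prod>i=1..m. c i)" using c by (rule prod_pos)
  then have B: "0 < B" using C L by (simp add: B_def)
  have "emeasure \<mu> (\<Delta> k) \<le> ennreal (B powr (p / q) * snd (\<zeta> k) powr (p / q * E))" for k
  proof -
    define \<rho> where "\<rho> = L * snd (\<zeta> k)"
    have \<rho>: "0 < \<rho>" using L \<eta> by (simp add: \<rho>_def)
    define a where "a = (fst (\<zeta> k), - \<rho>)"
    define f where "f z = K (z - a)" for z
    have "a \<notin> half_space" using \<rho> by (simp add: a_def half_space_def)
    then have harm: "harmonic_on half_space f"
      unfolding f_def using open_half_space by (rule K_harm[rotated])
    define g where "g = \<rho> powr - N / 2"
    have g: "0 < g" using \<rho> by (simp add: g_def)
    have f_ge: "g \<le> f z" if z: "z \<in> \<Delta> k" for z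
    proof -
      have "\<bar>(z - \<zeta> k) \<bullet> b\<bar> \<le> snd (\<zeta> k)" if "b \<in> Basis" for b
        using z that \<kappa>h[of k] mult_pos_pos[OF \<kappa> \<eta>[of k]] unfolding \<Delta> mem_axis_cube
        by (smt (verit))
      then have "norm (z - \<zeta> k) \<le> snd (\<zeta> k) * \<nu>"
        unfolding \<nu>_def using \<eta>[of k] by (intro norm_le_norm_One) auto
      moreover have "norm (\<zeta> k - (fst (\<zeta> k), 0)) = snd (\<zeta> k)"
        using \<eta>[of k] by (simp add: minus_prod_def norm_Pair)
      moreover have "norm (z - (fst (\<zeta> k), 0)) \<le> norm (z - \<zeta> k) + norm (\<zeta> k - (fst (\<zeta> k), 0))"
        using dist_triangle[of z "(fst (\<zeta> k), 0)" "\<zeta> k"] unfolding dist_norm .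
      ultimately have "norm (z - (fst (\<zeta> k), 0)) \<le> snd (\<zeta> k) * (\<nu> + 1)" by (simp add: algebra_simps)
      also have "\<dots> < snd (\<zeta> k) * (\<delta> * L)"
      proof (rule mult_strict_left_mono[OF _ \<eta>])
        have "\<delta> * L = \<nu> + 1 + \<delta>" using \<delta> by (simp add: L_def field_simps)
        then show "\<nu> + 1 < \<delta> * L" using \<delta> by simp
      qed
      finally have near: "norm (z - (fst (\<zeta> k), 0)) < \<delta> * \<rho>" by (simp add: \<rho>_def mult.commute mult.left_commute)
      define u where "u = (1 / \<rho>) *\<^sub>R (z - a)"
      have eq: "u - (0, 1) = (1 / \<rho>) *\<^sub>R (z - (fst (\<zeta> k), 0))"
        using \<rho> by (auto simp: u_def a_def prod_eq_iff algebra_simps add_divide_distrib)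
      have "norm (u - (0, 1)) < \<delta>"
        unfolding eq norm_scaleR using near \<rho> by (simp add: field_simps)
      from K_ge[OF \<rho> this] show ?thesis using \<rho> by (simp add: g_def f_def u_def)
    qed
    define x where "x = emeasure \<mu> (\<Delta> k)"
    have "ennreal_powr (ennreal (g powr (p * m)) * x) (q / p) \<le>
        ennreal_powr (\<integral>\<^sup>+z\<in>\<Delta> k. ennreal (\<Prod>i=1..m. \<bar>f z\<bar> powr p) \<partial>\<mu>) (q / p)"
    proof (rule ennreal_powr_mono)
      have "ennreal (g powr (p * m)) * x = (\<integral>\<^sup>+z. ennreal (g powr (p * m)) * indicator (\<Delta> k) z \<partial>\<mu>)"
        unfolding x_def using \<Delta>\<mu> by (rule nn_integral_cmult_indicator[symmetric])
      also have "\<dots> \<le> (\<integral>\<^sup>+z\<in>\<Delta> k. ennreal (\<Prod>i=1..m. \<bar>f z\<bar> powr p) \<partial>\<mu>)"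
      proof (rule nn_integral_mono)
        fix z
        show "ennreal (g powr (p * m)) * indicator (\<Delta> k) z \<le>
            ennreal (\<Prod>i=1..m. \<bar>f z\<bar> powr p) * indicator (\<Delta> k) z"
        proof (cases "z \<in> \<Delta> k")
          case True
          have "g powr (p * m) \<le> \<bar>f z\<bar> powr (p * m)"
            using f_ge[OF True] g p by (intro powr_mono2) auto
          also have "\<dots> = (\<Prod>i=1..m. \<bar>f z\<bar> powr p)"
            using f_ge[OF True] g by (simp add: powr_powr[symmetric] powr_realpow)
          finally show ?thesis using True by (simp add: ennreal_leI)
        qed simp
      qed
      finally show "ennreal (g powr (p * m)) * x \<le> (\<integral>\<^sup>+z\<in>\<Delta> k. ennreal (\<Prod>i=1..m. \<bar>f z\<bar> powr p) \<partial>\<mu>)" .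
    qed (use p q in simp)
    also have "\<dots> \<le> A_norm_powr \<Delta> p q m \<mu> (\<lambda>_. f)"
      unfolding A_norm_powr_def
      using sum_le_suminf[OF summableI, of "{k}"
        "\<lambda>k. ennreal_powr (\<integral>\<^sup>+z\<in>\<Delta> k. ennreal (\<Prod>i=1..m. \<bar>f z\<bar> powr p) \<partial>\<mu>) (q / p)"] by simp
    also have "\<dots> \<le> ennreal C * (\<Prod>i=1..m. I f i)"
      unfolding I_def using norm_le[of "\<lambda>_. f"] harm by simp
    also have "\<dots> \<le> ennreal C * (\<Prod>i=1..m. ennreal (c i * \<rho> powr (d + \<beta> i - N * q)))"
    proof (intro mult_left_mono prod_mono_ennreal)
      fix i assume i: "i \<in> {1..m}"
      show "I f i \<le> ennreal (c i * \<rho> powr (d + \<beta> i - N * q))"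
        using i \<rho> by (rule I_le[where a = a]) (simp_all add: a_def f_def K_le)
    qed auto
    also have "\<dots> = ennreal (C * (\<Prod>i=1..m. c i * \<rho> powr (d + \<beta> i - N * q)))"
      using C c by (subst prod_ennreal) (auto simp: ennreal_mult' less_imp_le)
    also have "(\<Prod>i=1..m. c i * \<rho> powr (d + \<beta> i - N * q)) = (\<Prod>i=1..m. c i) * \<rho> powr (E - N * q * m)"
    proof -
      have "(\<Sum>i=1..m. d + \<beta> i - N * q) = E - N * q * m"
        by (simp add: E_def sum_subtractf)
      then show ?thesis using \<rho> by (simp add: prod.distrib flip: powr_sum)
    qed
    finally have le: "ennreal_powr (ennreal (g powr (p * m)) * x) (q / p) \<le>
        ennreal (C * ((\<Prod>i=1..m. c i) * \<rho> powr (E - N * q * m)))" .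
    \<comment> \<open>Finiteness of \<mu> on cubes is not assumed but comes out of the estimate,
      because \<open>ennreal_powr\<close> sends \<open>top\<close> to \<open>top\<close>.\<close>
    have "x \<noteq> top"
    proof
      assume "x = top"
      then have "ennreal_powr (ennreal (g powr (p * m)) * x) (q / p) = top"
        using g by (simp add: ennreal_powr_def ennreal_mult_top)
      then show False using le by (simp add: top_unique)
    qed
    then obtain y where y: "0 \<le> y" "x = ennreal y" by (cases x) auto
    have "(g powr (p * m) * y) powr (q / p) \<le> C * ((\<Prod>i=1..m. c i) * \<rho> powr (E - N * q * m))"
    proof -
      have "ennreal ((g powr (p * m) * y) powr (q / p)) \<le> ennreal (C * ((\<Prod>i=1..m. c i) * \<rho> powr (E - N * q * m)))"
        using le y by (simp add: ennreal_powr_ennreal flip: ennreal_mult')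
      then show ?thesis using C cprod by (subst (asm) ennreal_le_iff) auto
    qed
    also have "(g powr (p * m) * y) powr (q / p) = 2 powr (- (q * m)) * \<rho> powr (- (N * q * m)) * y powr (q / p)"
    proof -
      have "(g powr (p * m)) powr (q / p) = g powr (q * m)" using p by (simp add: powr_powr mult.commute)
      also have "\<dots> = (\<rho> powr - N) powr (q * m) / 2 powr (q * m)"
        unfolding g_def by (rule powr_divide)
      also have "\<dots> = 2 powr (- (q * m)) * \<rho> powr (- (N * q * m))"
      proof -
        have "(\<rho> powr - N) powr (q * m) = \<rho> powr (- (N * q * m))"
          by (simp only: powr_powr mult.assoc mult_minus_left)
        then show ?thesis by (simp only: powr_minus[of 2] divide_inverse mult.commute)
      qed
      finally show ?thesis unfolding powr_mult by (rule arg_cong)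
    qed
    finally have "2 powr (- (q * m)) * \<rho> powr (- (N * q * m)) * y powr (q / p) \<le>
        C * ((\<Prod>i=1..m. c i) * \<rho> powr (E - N * q * m))" .
    \<comment> \<open>The inverse of the lower bound, as a factor, removes every power that contains
      \<open>N\<close>.\<close>
    then have "(2 powr (q * m) * \<rho> powr (N * q * m)) *
          (2 powr (- (q * m)) * \<rho> powr (- (N * q * m)) * y powr (q / p)) \<le>
        (2 powr (q * m) * \<rho> powr (N * q * m)) * (C * ((\<Prod>i=1..m. c i) * \<rho> powr (E - N * q * m)))"
      by (rule mult_left_mono) simp
    also have "(2 powr (q * m) * \<rho> powr (N * q * m)) *
          (2 powr (- (q * m)) * \<rho> powr (- (N * q * m)) * y powr (q / p)) = y powr (q / p)"
    proof -
      have "2 powr (q * m) * 2 powr (- (q * m)) = (1 :: real)"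
        and "\<rho> powr (N * q * m) * \<rho> powr (- (N * q * m)) = 1"
        using \<rho> by (simp_all flip: powr_add)
      then have "(2 powr (q * m) * 2 powr (- (q * m))) * (\<rho> powr (N * q * m) * \<rho> powr (- (N * q * m))) *
          y powr (q / p) = y powr (q / p)" by (simp only: mult_1)
      then show ?thesis by (simp only: mult.assoc mult.left_commute)
    qed
    also have "(2 powr (q * m) * \<rho> powr (N * q * m)) * (C * ((\<Prod>i=1..m. c i) * \<rho> powr (E - N * q * m))) =
        B * snd (\<zeta> k) powr E"
      using \<rho> by (simp add: B_def powr_diff \<rho>_def powr_mult)
    finally have "y powr (q / p) \<le> B * snd (\<zeta> k) powr E" .
    then have "(y powr (q / p)) powr (p / q) \<le> (B * snd (\<zeta> k) powr E) powr (p / q)"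
      using p q by (intro powr_mono2) auto
    also have "(y powr (q / p)) powr (p / q) = y" using p q y(1) by (simp add: powr_powr)
    also have "(B * snd (\<zeta> k) powr E) powr (p / q) = B powr (p / q) * snd (\<zeta> k) powr (p / q * E)"
      by (simp add: powr_mult powr_powr mult.commute)
    finally show ?thesis using y(2) by (simp add: x_def ennreal_leI)
  qed
  moreover have "0 < B powr (p / q)" using B by simp
  ultimately show ?thesis unfolding E_def \<beta>_def by blast
qed

theorem theorem4:
  fixes \<Delta> :: "nat \<Rightarrow> ((real ^ 'n) \<times> real) set"
    and \<zeta> :: "nat \<Rightarrow> (real ^ 'n) \<times> real"
    and \<mu> :: "((real ^ 'n) \<times> real) measure"
    and p q :: real
    and m :: nat
    and \<sigma> \<alpha> :: "nat \<Rightarrow> real"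
  assumes "whitney_decomposition \<Delta> \<zeta>"
    and "0 < p" and "0 < q" and "1 \<le> m"
    and "\<And>i. i \<in> {1..m} \<Longrightarrow> 0 < \<sigma> i \<and> \<sigma> i \<le> q"
    and "\<And>i. i \<in> {1..m} \<Longrightarrow> -1 < \<alpha> i"
    and "sets \<mu> = sets (restrict_space borel half_space)"
  shows
    "(\<exists>C::real. 0 < C \<and>
        (\<forall>f :: nat \<Rightarrow> (real ^ 'n) \<times> real \<Rightarrow> real.
           (\<forall>i\<in>{1..m}. harmonic_on half_space (f i)) \<longrightarrow>
           A_norm_powr \<Delta> p q m \<mu> f
             \<le> ennreal C *
                (\<Prod>i=1..m. \<integral>\<^sup>+w\<in>half_space.
                   ennreal_powr
                     (\<integral>\<^sup>+z\<in>Q_cube w. ennreal (\<bar>f i z\<bar> powr \<sigma> i * snd z powr \<alpha> i) \<partial>lborel)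
                     (q / \<sigma> i) \<partial>lborel)))
     \<longleftrightarrow>
     (\<exists>C::real. 0 < C \<and>
        (\<forall>k. emeasure \<mu> (\<Delta> k)
           \<le> ennreal (C * snd (\<zeta> k) powr
                (real m * (real CARD('n) + 1) * (p / q) +
                 (\<Sum>i=1..m. p * (real CARD('n) + 1 + \<alpha> i) / \<sigma> i)))))"
proof -
  let ?d = "real DIM((real ^ 'n) \<times> real)"
  have \<sigma>: "\<And>i. i \<in> {1..m} \<Longrightarrow> 0 < \<sigma> i" using assms(5) by blast
  have \<Delta>\<mu>: "\<Delta> k \<in> sets \<mu>" for k
  proof -
    obtain l where "\<Delta> k = axis_cube (\<zeta> k) l"
      using whitney_decomposition_cube[OF assms(1)] by blast
    then have "\<Delta> k \<in> sets borel" by (simp add: axis_cube_def)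
    moreover have "\<Delta> k \<subseteq> half_space" using assms(1) by (auto simp: whitney_decomposition_def)
    moreover have "half_space \<in> sets (borel :: ((real ^ 'n) \<times> real) measure)"
      by (rule borel_open[OF open_half_space])
    ultimately show ?thesis by (simp add: assms(7) sets_restrict_space_iff)
  qed
  have d: "?d = real CARD('n) + 1" by simp
  \<comment> \<open>The term \<open>real m * (real CARD('n) + 1) * (p / q)\<close> is shared out
    equally among the \<open>m\<close> summands; both implications use the resulting form with
    \<open>p / q\<close> in front.\<close>
  have exponent: "real m * (real CARD('n) + 1) * (p / q) +
      (\<Sum>i=1..m. p * (real CARD('n) + 1 + \<alpha> i) / \<sigma> i) =
      p / q * (\<Sum>i=1..m. ?d + (?d + \<alpha> i) * q / \<sigma> i)"
  proof -
    have "real m * D * (p / q) + (\<Sum>i=1..m. p * (D + \<alpha> i) / \<sigma> i) =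
        p / q * (\<Sum>i=1..m. D + (D + \<alpha> i) * q / \<sigma> i)" for D
    proof -
      have "p / q * (\<Sum>i=1..m. D + (D + \<alpha> i) * q / \<sigma> i) =
          (\<Sum>i=1..m. D * (p / q) + p * (D + \<alpha> i) / \<sigma> i)"
        unfolding sum_distrib_left
      proof (rule sum.cong[OF refl])
        fix i assume "i \<in> {1..m}"
        from \<sigma>[OF this] assms(3)
        show "p / q * (D + (D + \<alpha> i) * q / \<sigma> i) = D * (p / q) + p * (D + \<alpha> i) / \<sigma> i"
          by (simp add: field_simps)
      qed
      then show ?thesis by (simp add: sum.distrib)
    qed
    then show ?thesis unfolding d .
  qed
  show ?thesis
    unfolding exponent
  proof (intro iffI; elim exE conjE)
    fix C :: real
    assume C: "0 < C" and "\<forall>f :: nat \<Rightarrow> (real ^ 'n) \<times> real \<Rightarrow> real. (\<forall>i\<in>{1..m}. harmonic_on half_space (f i)) \<longrightarrow>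
      A_norm_powr \<Delta> p q m \<mu> f \<le> ennreal C * (\<Prod>i=1..m. \<integral>\<^sup>+w\<in>half_space. ennreal_powr
        (\<integral>\<^sup>+z\<in>Q_cube w. ennreal (\<bar>f i z\<bar> powr \<sigma> i * snd z powr \<alpha> i) \<partial>lborel) (q / \<sigma> i) \<partial>lborel)"
    then show "\<exists>C>0. \<forall>k. emeasure \<mu> (\<Delta> k) \<le>
        ennreal (C * snd (\<zeta> k) powr (p / q * (\<Sum>i=1..m. ?d + (?d + \<alpha> i) * q / \<sigma> i)))"
      by (intro emeasure_whitney_le[OF assms(1-3) \<sigma> assms(6) \<Delta>\<mu> C]) blast+
  next
    fix C :: real
    assume "0 < C" "\<forall>k. emeasure \<mu> (\<Delta> k) \<le>
        ennreal (C * snd (\<zeta> k) powr (p / q * (\<Sum>i=1..m. ?d + (?d + \<alpha> i) * q / \<sigma> i)))"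
    then show "\<exists>C>0. \<forall>f :: nat \<Rightarrow> (real ^ 'n) \<times> real \<Rightarrow> real. (\<forall>i\<in>{1..m}. harmonic_on half_space (f i)) \<longrightarrow>
      A_norm_powr \<Delta> p q m \<mu> f \<le> ennreal C * (\<Prod>i=1..m. \<integral>\<^sup>+w\<in>half_space. ennreal_powr
        (\<integral>\<^sup>+z\<in>Q_cube w. ennreal (\<bar>f i z\<bar> powr \<sigma> i * snd z powr \<alpha> i) \<partial>lborel) (q / \<sigma> i) \<partial>lborel)"
      by (intro A_norm_powr_le[OF assms(1-4) \<sigma> \<Delta>\<mu>]) blast+
  qed
qed

end
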